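(* Let $w$ be a non-decreasing weight sequence (with values in $(0,\infty)$) such that $$w(k)\underset{k\to\infty}{\sim}\frac{k}{\exp(\log^\alpha k)}\qquad\text{for some }\alpha\in(0,1).$$ Then $i_-(w)$ and $i_+(w)$ are both finite. Moreover, for every integer $n\ge1$, $$\alpha\in\left(\frac{n-1}{n},\frac{n}{n+1}\right)\quad\Longrightarrow\quad i_-(w)=i_+(w)=n+1.$$
   Context: Here $\log^\alpha k=(\log k)^\alpha$. The sequence $w$ is extended to a continuous non-decreasing function $w:[0,\infty)\to(0,\infty)$ by linear interpolation. Set $W(x):=\int_0^x\frac{du}{w(u)}$, an increasing homeomorphism of $[0,\infty)$ with inverse $W^{-1}$. For measurable $f\ge0$ on $[0,\infty)$, $G(f)(x):=\int_0^x\frac{w(W^{-1}(f(u)))}{w(W^{-1}(u))}\,du$, and $G^{(n)}$ is the $n$-fold iterate of $G$. For $\eta\in(0,1)$, $i_\eta(w):=\inf\{n\ge2: G^{(n-1)}(\eta\,\mathrm{Id})\text{ is bounded}\}$, with $\mathrm{Id}$ the identity function and $\inf\emptyset=+\infty$. The map $\eta\mapsto i_\eta(w)$ is non-decreasing, and $i_\pm(w):=\lim_{\eta\to(1/2)^\pm}i_\eta(w)$ (right limit for $+$, left limit for $-$). *)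

theory Defs
  imports "HOL-Analysis.Analysis" "HOL-Library.Landau_Symbols"
begin

definition interp :: "(nat \<Rightarrow> real) \<Rightarrow> real \<Rightarrow> real" where
  "interp w x = w (nat \<lfloor>x\<rfloor>) + frac x * (w (Suc (nat \<lfloor>x\<rfloor>)) - w (nat \<lfloor>x\<rfloor>))"

definition W :: "(nat \<Rightarrow> real) \<Rightarrow> real \<Rightarrow> real" where
  "W w x = (LINT u:{0..x}|lborel. 1 / interp w u)"

definition W_inv :: "(nat \<Rightarrow> real) \<Rightarrow> real \<Rightarrow> real" where
  "W_inv w = inv_into {0..} (W w)"

(* The integral is the real-valued Lebesgue integral.  It is only ever applied to the iterates
   starting from \<eta> Id; these are continuous on [0,\<infinity>), so the integrand is locally bounded there
   and no question of infinite values of the integral arises. *)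
definition G :: "(nat \<Rightarrow> real) \<Rightarrow> (real \<Rightarrow> real) \<Rightarrow> real \<Rightarrow> real" where
  "G w f x = (LINT u:{0..x}|lborel. interp w (W_inv w (f u)) / interp w (W_inv w u))"

(* In enat the infimum of the empty set is \<infinity>. *)
definition i_eta :: "(nat \<Rightarrow> real) \<Rightarrow> real \<Rightarrow> enat" where
  "i_eta w \<eta> = (INF n \<in> {n. n \<ge> 2 \<and> bounded (((G w ^^ (n - 1)) (\<lambda>x. \<eta> * x)) ` {0..})}. enat n)"

(* Limits in the order topology of enat.  They exist because \<eta> \<mapsto> i_eta w \<eta> is non-decreasing
   on (0,1). *)
definition i_minus :: "(nat \<Rightarrow> real) \<Rightarrow> enat" where
  "i_minus w = Lim (at_left (1/2)) (i_eta w)"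

definition i_plus :: "(nat \<Rightarrow> real) \<Rightarrow> enat" where
  "i_plus w = Lim (at_right (1/2)) (i_eta w)"

end

theory Submission
  imports Defs "HOL-Real_Asymp.Real_Asymp"
begin

text \<open>
  Write \<open>H = w \<circ> W\<inverse>\<close>, so that \<open>G f\<close> is the primitive of \<open>H (f u) / H u\<close>, and put
  \<open>\<beta> = 1/\<alpha> - 1 > 0\<close>. Everything rests on how \<open>ln H\<close> varies on the logarithmic scale.

  If \<open>u = W x\<close>, then \<open>W x\<close> has the order of magnitude of \<open>ln\<^bsup>1 - \<alpha>\<^esup> x \<cdot> exp (ln\<^sup>\<alpha> x)\<close>, whose derivative has
  the order of magnitude of \<open>1 / w x\<close>. Consequently \<open>ln u\<close> and \<open>ln\<^sup>\<alpha> x\<close> have comparable increments, while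
  \<open>ln (H u) = ln x - ln\<^sup>\<alpha> x + O(1)\<close>, which behaves like \<open>(ln\<^sup>\<alpha> x)\<^bsup>1/\<alpha>\<^esup>\<close>, the power \<open>1/\<alpha>\<close> of a quantity
  comparable to \<open>ln u\<close>. This gives, for large \<open>v \<le> u\<close>, the two-sided estimate
  (\<open>ln_interp_W_inv_increments\<close>)
  \<open>ln (H u) - ln (H v) \<approx> ln\<^sup>\<beta> u \<cdot> (ln u - ln v)\<close>, up to constant factors and a bounded error.

  Suppose now that \<open>f u\<close> is of the form \<open>u \<cdot> exp (- d \<cdot> ln\<^sup>\<gamma> u)\<close>. Then \<open>H (f u) / H u\<close> is of the form
  \<open>exp (- d' \<cdot> ln\<^bsup>\<gamma> + \<beta>\<^esup> u)\<close> (\<open>ratio_upper_bound\<close>, \<open>ratio_lower_bound\<close>). If \<open>\<gamma> + \<beta> > 1\<close> this is integrable,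
  and \<open>G f\<close> is bounded (\<open>bounded_\<Gamma>\<close>). If \<open>\<gamma> + \<beta> < 1\<close>, integration amounts to multiplication by the variable
  and a change of \<open>d'\<close> (\<open>\<Gamma>_upper_bound\<close>, \<open>\<Gamma>_lower_bound\<close>), so that \<open>G f\<close> has the same form with \<open>\<gamma> + \<beta>\<close> in place of \<open>\<gamma>\<close>.
  The start \<open>\<eta> \<cdot> Id\<close> is the case \<open>\<gamma> = 0\<close>, \<open>d = - ln \<eta>\<close>, so the \<open>k\<close>-th iterate has exponent \<open>k \<cdot> \<beta>\<close>. It is
  unbounded as long as \<open>k \<cdot> \<beta> < 1\<close> and is bounded at the first \<open>k\<close> with \<open>k \<cdot> \<beta> > 1\<close>, for every
  \<open>\<eta> \<in> (0,1)\<close>. The condition \<open>(n - 1) \<cdot> \<beta> < 1 < n \<cdot> \<beta>\<close> says precisely that \<open>\<alpha>\<close> lies strictly between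
  \<open>(n - 1) / n\<close> and \<open>n / (n + 1)\<close>, and then \<open>i_eta\<close> is constantly \<open>n + 1\<close>.

  When some \<open>k \<cdot> \<beta>\<close> equals \<open>1\<close>, the upper bound for the iterates is still available, so that the next iterate is
  bounded, but boundedness of the \<open>k\<close>-th one may depend on \<open>\<eta>\<close>. Still \<open>i_eta\<close> is
  finite and non-decreasing in \<open>\<eta>\<close>, hence constant on one-sided neighbourhoods of \<open>1/2\<close>, and its
  one-sided limits are among its finite values (\<open>Lim_one_sided_finite\<close>).
\<close>

section \<open>Calculus on the half-line\<close>

lemma continuous_on_halfline:
  fixes f :: "real \<Rightarrow> real"
  assumes "\<And>b. 0 < b \<Longrightarrow> \<exists>c>b. continuous_on {0..c} f"
  shows "continuous_on {0..} f"
  unfolding continuous_on_eq_continuous_within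
proof
  fix x :: real assume x: "x \<in> {0..}"
  obtain c where c: "c > x + 1" "continuous_on {0..c} f"
    using assms[of "x + 1"] x by auto
  have "at x within {0..} = at x within {0..c}"
    by (rule at_within_nhd[of x "{..<c}"]) (use c in auto)
  moreover have "continuous (at x within {0..c}) f"
    using c x by (auto simp: continuous_on_eq_continuous_within)
  ultimately show "continuous (at x within {0..}) f"
    by (simp add: continuous_within)
qed

lemma primitive_eq_integral:
  fixes g :: "real \<Rightarrow> real"
  assumes "continuous_on {0..} g" "0 \<le> x"
  shows "(LINT u:{0..x}|lborel. g u) = integral {0..x} g"
  by (rule set_borel_integral_eq_integral(2))
     (intro borel_integrable_atLeastAtMost' continuous_on_subset[OF assms(1)], auto)

lemma primitive_has_derivative:
  fixes g :: "real \<Rightarrow> real"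
  assumes g: "continuous_on {0..} g" and x: "0 \<le> x"
  shows "((\<lambda>x. LINT u:{0..x}|lborel. g u) has_real_derivative g x) (at x within {0..})"
proof -
  have "((\<lambda>y. integral {0..y} g) has_real_derivative g x) (at x within {0..x+1})"
    by (rule integral_has_real_derivative) (use x in \<open>auto intro: continuous_on_subset[OF g]\<close>)
  moreover have "at x within {0..x+1} = at x within {0..}"
    by (rule at_within_nhd[of x "{..<x+1}"]) auto
  ultimately have "((\<lambda>y. integral {0..y} g) has_real_derivative g x) (at x within {0..})" by simp
  then show ?thesis
    by (rule has_field_derivative_transform_within[OF _ zero_less_one])
       (use x primitive_eq_integral[OF g] in auto)
qed

lemma primitive_has_derivative_at:
  fixes g :: "real \<Rightarrow> real"
  assumes "continuous_on {0..} g" "0 < x"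
  shows "((\<lambda>x. LINT u:{0..x}|lborel. g u) has_real_derivative g x) (at x)"
proof -
  have "at x within {0..} = at x" by (rule at_within_interior) (use assms in simp)
  then show ?thesis using primitive_has_derivative[OF assms(1), of x] assms(2) by simp
qed

lemma continuous_on_primitive:
  fixes g :: "real \<Rightarrow> real"
  assumes "continuous_on {0..} g"
  shows "continuous_on {0..} (\<lambda>x. LINT u:{0..x}|lborel. g u)"
  by (rule DERIV_continuous_on) (use primitive_has_derivative[OF assms] in auto)

text \<open>Integral comparisons below are all carried out through this form of the mean value
  theorem: an integral is bounded by guessing a majorant and differentiating it.\<close>

lemma diff_le_of_deriv_le:
  fixes f g :: "real \<Rightarrow> real"
  assumes "x \<le> y"
    and "\<And>z. x \<le> z \<Longrightarrow> z \<le> y \<Longrightarrow> (f has_real_derivative f' z) (at z)"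
    and "\<And>z. x \<le> z \<Longrightarrow> z \<le> y \<Longrightarrow> (g has_real_derivative g' z) (at z)"
    and "\<And>z. x \<le> z \<Longrightarrow> z \<le> y \<Longrightarrow> f' z \<le> g' z"
  shows "f y - f x \<le> g y - g x"
proof -
  have "(\<lambda>z. g z - f z) x \<le> (\<lambda>z. g z - f z) y"
  proof (rule DERIV_nonneg_imp_nondecreasing[OF assms(1)])
    fix z assume z: "x \<le> z" "z \<le> y"
    show "\<exists>D. ((\<lambda>z. g z - f z) has_real_derivative D) (at z) \<and> 0 \<le> D"
      using DERIV_diff[OF assms(3)[OF z] assms(2)[OF z]] assms(4)[OF z] by force
  qed
  then show ?thesis by simp
qed

lemma ln_ge_one_above:
  fixes x0 x :: real
  assumes "1 \<le> ln x0" "0 < x0" "x0 \<le> x"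
  shows "1 \<le> ln x" "1 < x"
proof -
  show "1 \<le> ln x" using assms ln_le_cancel_iff[of x0 x] by linarith
  then show "1 < x" using assms ln_gt_zero_iff[of x] by linarith
qed

text \<open>By concavity of the power \<open>a\<close>, the slope of its chord over \<open>[s, t]\<close> is at most the slope
  \<open>t powr (a - 1)\<close> of the chord over \<open>[0, t]\<close>, and at least the derivative
  \<open>a * t powr (a - 1)\<close> at \<open>t\<close>.\<close>

lemma powr_diff_bounds:
  fixes a s t :: real
  assumes a: "0 < a" "a < 1" and st: "0 < s" "s \<le> t"
  shows "t powr (1 - a) * (t powr a - s powr a) \<le> t - s"
    and "t - s \<le> (1 / a) * (t powr (1 - a) * (t powr a - s powr a))"
proof -
  have t: "t powr (1 - a) * t powr a = t" using st by (simp flip: powr_add)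
  have "s = s powr (1 - a) * s powr a" using st by (simp flip: powr_add)
  also have "\<dots> \<le> t powr (1 - a) * s powr a"
    using st a by (intro mult_right_mono powr_mono2) auto
  finally show "t powr (1 - a) * (t powr a - s powr a) \<le> t - s"
    using t by (simp add: algebra_simps)
  have "(a * t powr (a - 1)) * t - (a * t powr (a - 1)) * s \<le> t powr a - s powr a"
  proof (rule diff_le_of_deriv_le[OF st(2)])
    fix z assume z: "s \<le> z" "z \<le> t"
    show "((*) (a * t powr (a - 1)) has_real_derivative a * t powr (a - 1)) (at z)"
      by (auto intro!: derivative_eq_intros)
    show "((\<lambda>z. z powr a) has_real_derivative a * z powr (a - 1)) (at z)"
      using z st by (auto intro!: derivative_eq_intros)
    show "a * t powr (a - 1) \<le> a * z powr (a - 1)"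
      using z st a by (intro mult_left_mono powr_mono2') auto
  qed
  then have "t powr (1 - a) * ((a * t powr (a - 1)) * (t - s)) \<le> t powr (1 - a) * (t powr a - s powr a)"
    by (intro mult_left_mono) (auto simp: algebra_simps)
  moreover have "t powr (1 - a) * t powr (a - 1) = 1" using st by (simp flip: powr_add)
  then have "t powr (1 - a) * ((a * t powr (a - 1)) * (t - s)) = a * (t - s)"
    by (simp add: algebra_simps)
  ultimately show "t - s \<le> (1 / a) * (t powr (1 - a) * (t powr a - s powr a))"
    using a by (simp add: field_simps)
qed

lemma eventually_exp_neg_ln_powr_le:
  fixes c \<delta> \<epsilon> :: real
  assumes "0 < c" "0 < \<delta>" "0 < \<epsilon>"
  shows "eventually (\<lambda>x. exp (- c * ln x powr \<delta>) \<le> \<epsilon>) at_top"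
proof -
  have "eventually (\<lambda>x. - ln \<epsilon> \<le> c * ln x powr \<delta>) at_top"
    using assms(1,2) by real_asymp
  then show ?thesis
  proof eventually_elim
    case (elim x)
    then have "exp (- c * ln x powr \<delta>) \<le> exp (ln \<epsilon>)" by (subst exp_le_cancel_iff) simp
    then show ?case using assms(3) by simp
  qed
qed

text \<open>The logarithm \<open>ln x - c \<cdot> ln\<^sup>\<gamma> x\<close> tends to infinity, at a linear rate in \<open>ln x\<close>. At
  \<open>\<gamma> = 1\<close> the constant matters: the function is \<open>x\<^bsup>1 - c\<^esup>\<close>.\<close>

lemma filterlim_x_exp_neg_ln_powr:
  fixes c \<gamma> :: real
  assumes "0 < c" "0 \<le> \<gamma>" "\<gamma> < 1 \<or> \<gamma> = 1 \<and> c < 1"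
  shows "filterlim (\<lambda>x. x * exp (- c * ln x powr \<gamma>)) at_top at_top"
proof -
  have "filterlim (\<lambda>x. ln x - c * ln x powr \<gamma>) at_top at_top"
  proof (cases "\<gamma> = 1")
    case True
    then have "filterlim (\<lambda>x. ln x - c * ln x) at_top at_top"
      using assms by real_asymp
    moreover have "eventually (\<lambda>x::real. ln x - c * ln x \<le> ln x - c * ln x powr \<gamma>) at_top"
      using eventually_ge_at_top[of 1] by eventually_elim (simp add: True)
    ultimately show ?thesis by (rule filterlim_at_top_mono)
  next
    case False
    then have "\<gamma> < 1" using assms by auto
    with assms(1,2) show ?thesis by real_asymp
  qed
  from filterlim_compose[OF exp_at_top this]
  have "filterlim (\<lambda>x. exp (ln x - c * ln x powr \<gamma>)) at_top at_top" .
  moreover have "eventually (\<lambda>x. exp (ln x - c * ln x powr \<gamma>) \<le> x * exp (- c * ln x powr \<gamma>)) at_top"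
    using eventually_gt_at_top[of 0] by eventually_elim (simp add: exp_diff exp_minus field_simps)
  ultimately show ?thesis by (rule filterlim_at_top_mono)
qed

text \<open>When \<open>\<delta> < 1\<close>, or \<open>\<delta> = 1\<close> and \<open>d < 1\<close>, the first factor of the derivative is eventually
  between positive constants if \<open>d > 0\<close>. Hence the primitives of \<open>exp (- d * ln x powr \<delta>)\<close>
  are comparable to \<open>x * exp (- d * ln x powr \<delta>)\<close>.\<close>

lemma x_exp_has_derivative:
  assumes "1 < x"
  shows "((\<lambda>x. x * exp (- d * ln x powr \<delta>)) has_real_derivative
    (1 - d * \<delta> * ln x powr (\<delta> - 1)) * exp (- d * ln x powr \<delta>)) (at x)"
proof -
  have "0 < ln x" using assms by simp
  then show ?thesis using assms by (auto intro!: derivative_eq_intros simp: algebra_simps)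
qed

section \<open>The interpolated weight and the time change it generates\<close>

lemma interp_affine_on_unit_interval:
  assumes "real n \<le> x" "x \<le> real n + 1"
  shows "interp w x = w n + (x - real n) * (w (Suc n) - w n)"
proof (cases "x = real n + 1")
  case True
  then have "nat \<lfloor>x\<rfloor> = Suc n" "frac x = 0"
    by (simp_all add: frac_def nat_add_distrib)
  then show ?thesis using True by (simp add: interp_def)
next
  case False
  then have "\<lfloor>x\<rfloor> = int n" using assms by linarith
  then show ?thesis by (simp add: interp_def frac_def)
qed

lemma continuous_on_interp: "continuous_on {0..} (interp w)"
proof (rule continuous_on_halfline)
  have *: "continuous_on {0..real n} (interp w)" for n
  proof (induction n)
    case (Suc n)
    have "continuous_on {real n..real (Suc n)} (\<lambda>x. w n + (x - real n) * (w (Suc n) - w n))"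
      by (intro continuous_intros)
    then have "continuous_on {real n..real (Suc n)} (interp w)"
      by (rule continuous_on_eq) (simp add: interp_affine_on_unit_interval[of n])
    with Suc have "continuous_on ({0..real n} \<union> {real n..real (Suc n)}) (interp w)"
      by (intro continuous_on_closed_Un) auto
    moreover have "{0..real n} \<union> {real n..real (Suc n)} = {0..real (Suc n)}" by auto
    ultimately show ?case by simp
  qed auto
  fix b :: real
  obtain n where "b < real n" using reals_Archimedean2 by blast
  with * show "\<exists>c>b. continuous_on {0..c} (interp w)" by blast
qed

lemma interp_bounds:
  assumes "mono w" "0 \<le> x"
  shows "w (nat \<lfloor>x\<rfloor>) \<le> interp w x" "interp w x \<le> w (Suc (nat \<lfloor>x\<rfloor>))"
proof -
  have d: "0 \<le> w (Suc (nat \<lfloor>x\<rfloor>)) - w (nat \<lfloor>x\<rfloor>)" using assms(1) by (simp add: monoD)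
  have f: "0 \<le> frac x" "frac x \<le> 1" by (simp_all add: frac_lt_1 less_imp_le)
  show "w (nat \<lfloor>x\<rfloor>) \<le> interp w x" using d f by (simp add: interp_def)
  show "interp w x \<le> w (Suc (nat \<lfloor>x\<rfloor>))"
    using mult_right_mono[OF f(2) d] by (simp add: interp_def)
qed

lemma interp_mono:
  assumes "mono w" "0 \<le> x" "x \<le> y"
  shows "interp w x \<le> interp w y"
proof (cases "\<lfloor>x\<rfloor> = \<lfloor>y\<rfloor>")
  case True
  then have "frac x \<le> frac y" using assms by (simp add: frac_def)
  moreover have "0 \<le> w (Suc (nat \<lfloor>x\<rfloor>)) - w (nat \<lfloor>x\<rfloor>)" using assms(1) by (simp add: monoD)
  ultimately show ?thesis using True by (simp add: interp_def mult_right_mono)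
next
  case False
  then have "\<lfloor>x\<rfloor> < \<lfloor>y\<rfloor>" using floor_mono[OF assms(3)] by linarith
  then have "Suc (nat \<lfloor>x\<rfloor>) \<le> nat \<lfloor>y\<rfloor>" using assms by linarith
  then show ?thesis
    using interp_bounds[OF assms(1), of x] interp_bounds[OF assms(1), of y] assms
    by (smt (verit) monoD)
qed

lemma interp_pos:
  assumes "\<And>k. w k > 0" "mono w" "0 \<le> x"
  shows "interp w x > 0"
  using interp_bounds(1)[OF assms(2,3)] assms(1) less_le_trans by blast

context
  fixes w :: "nat \<Rightarrow> real"
  assumes w_pos: "\<And>k. w k > 0" and w_mono: "mono w"
begin

lemma continuous_on_inverse_interp: "continuous_on {0..} (\<lambda>u. 1 / interp w u)"
  by (intro continuous_intros continuous_on_interp)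
     (use interp_pos[of w, OF w_pos w_mono] in \<open>force\<close>)

lemma W_has_derivative: "0 < x \<Longrightarrow> (W w has_real_derivative 1 / interp w x) (at x)"
  using primitive_has_derivative_at[OF continuous_on_inverse_interp, of x]
  unfolding W_def[abs_def] .

lemma continuous_on_W: "continuous_on {0..} (W w)"
  using continuous_on_primitive[OF continuous_on_inverse_interp] unfolding W_def[abs_def] .

lemma W_0: "W w 0 = 0"
  unfolding W_def using primitive_eq_integral[OF continuous_on_inverse_interp, of 0] by simp

lemma W_strict_mono:
  assumes "0 \<le> x" "x < y"
  shows "W w x < W w y"
proof (rule DERIV_pos_imp_increasing_open[OF assms(2)])
  show "\<exists>D. (W w has_real_derivative D) (at z) \<and> 0 < D" if "x < z" "z < y" for z
    using W_has_derivative[of z] interp_pos[of w z, OF w_pos w_mono] that assms by force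
  show "continuous_on {x..y} (W w)" 
    by (rule continuous_on_subset[OF continuous_on_W]) (use assms in auto)
qed

context
  assumes W_unbounded: "filterlim (W w) at_top at_top"
begin

lemma W_surj:
  assumes "0 \<le> y"
  shows "\<exists>x\<ge>0. W w x = y"
proof -
  have "eventually (\<lambda>x. W w x \<ge> y) at_top"
    using W_unbounded by (simp add: filterlim_at_top)
  then obtain b where b: "b \<ge> 0" "W w b \<ge> y"
    by (metis (no_types, lifting) eventually_at_top_linorder nle_le)
  have "\<exists>x\<ge>0. x \<le> b \<and> W w x = y"
    by (rule IVT') (use b assms W_0 continuous_on_subset[OF continuous_on_W] in auto)
  then show ?thesis by blast
qed

lemma inj_on_W: "inj_on (W w) {0..}"
  by (rule linorder_inj_onI) (use W_strict_mono in force)+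

lemma W_inv_W: "0 \<le> x \<Longrightarrow> W_inv w (W w x) = x"
  unfolding W_inv_def using inj_on_W by (simp add: inv_into_f_f)

lemma W_W_inv: "0 \<le> y \<Longrightarrow> W w (W_inv w y) = y"
  and W_inv_nonneg: "0 \<le> y \<Longrightarrow> 0 \<le> W_inv w y"
  using W_surj W_inv_W by metis+

lemma W_inv_mono:
  assumes "0 \<le> x" "x \<le> y"
  shows "W_inv w x \<le> W_inv w y"
  using W_strict_mono[of "W_inv w y" "W_inv w x"] W_W_inv[of x] W_W_inv[of y] W_inv_nonneg[of y] assms
  by force

lemma continuous_on_W_inv: "continuous_on {0..} (W_inv w)"
proof (rule continuous_on_halfline)
  fix y :: real assume "0 < y"
  then obtain b where b: "b \<ge> 0" "W w b = y + 1" using W_surj[of "y+1"] by auto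
  have "continuous_on (W w ` {0..b}) (W_inv w)"
    by (rule continuous_on_inv)
       (use W_inv_W continuous_on_subset[OF continuous_on_W] in auto)
  moreover have "{0..y+1} \<subseteq> W w ` {0..b}"
  proof
    fix z assume "z \<in> {0..y+1}"
    then have "W_inv w z \<in> {0..b}" "z = W w (W_inv w z)"
      using W_W_inv[of z] W_inv_nonneg[of z] W_inv_mono[of z "y+1"] W_inv_W[of b] b by auto
    then show "z \<in> W w ` {0..b}" by blast
  qed
  ultimately have "continuous_on {0..y+1} (W_inv w)" by (rule continuous_on_subset)
  then show "\<exists>c>y. continuous_on {0..c} (W_inv w)" by (intro exI[of _ "y+1"]) auto
qed

end
end

section \<open>Increments of the logarithmic rate\<close>

context
  fixes w :: "nat \<Rightarrow> real" and a :: real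
  assumes w_pos: "\<And>k. w k > 0" and w_mono: "mono w"
    and a: "0 < a" "a < 1"
    and asymp: "w \<sim>[at_top] (\<lambda>k. real k / exp (ln (real k) powr a))"
begin

text \<open>The factor \<open>4\<close> is the product of a factor \<open>2\<close> from the asymptotic equivalence and a
  factor \<open>2\<close> from the passage between \<open>x\<close> and the neighbouring integers. The exponential
  costs nothing: it is smaller at the integer below \<open>x\<close>, which helps in the lower bound,
  and larger at the one above, which helps in the upper bound.\<close>

lemma interp_two_sided_bound:
  "\<exists>x0. 1 \<le> ln x0 \<and> 0 < x0 \<and>
     (\<forall>x\<ge>x0. x / exp (ln x powr a) / 4 \<le> interp w x \<and> interp w x \<le> 4 * (x / exp (ln x powr a)))"
proof -
  have "((\<lambda>k. w k / (real k / exp (ln (real k) powr a))) \<longlongrightarrow> 1) at_top"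
    using asymp_equivD_strong[OF asymp] w_pos by (simp add: less_imp_neq[symmetric])
  from order_tendstoD(1)[OF this, of "1/2"] order_tendstoD(2)[OF this, of 2]
  have "eventually (\<lambda>k. 1/2 < w k / (real k / exp (ln (real k) powr a)) \<and>
          w k / (real k / exp (ln (real k) powr a)) < 2) at_top"
    by (simp add: eventually_conj)
  then obtain N where N: "\<And>k. k \<ge> N \<Longrightarrow> 1/2 < w k / (real k / exp (ln (real k) powr a)) \<and>
          w k / (real k / exp (ln (real k) powr a)) < 2"
    by (auto simp: eventually_at_top_linorder)
  define x0 where "x0 = real N + 3"
  have "exp 1 \<le> x0" using exp_le unfolding x0_def by linarith
  then have "ln (exp 1) \<le> ln x0" by (subst ln_le_cancel_iff) (auto simp: x0_def)
  moreover have "x / exp (ln x powr a) / 4 \<le> interp w x \<and> interp w x \<le> 4 * (x / exp (ln x powr a))"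
    if x: "x0 \<le> x" for x
  proof
    let ?k = "nat \<lfloor>x\<rfloor>"
    have x3: "x \<ge> 3" using x by (simp add: x0_def)
    have k: "?k \<ge> N" "real ?k \<le> x" "x \<le> real (Suc ?k)" "x / 2 \<le> real ?k" "real (Suc ?k) \<le> 2 * x"
         "real ?k \<ge> 2"
      using x x3 unfolding x0_def by linarith+
    have "x / exp (ln x powr a) / 4 \<le> (real ?k / exp (ln (real ?k) powr a)) / 2"
    proof -
      have "exp (ln (real ?k) powr a) \<le> exp (ln x powr a)"
        using k x3 a by (auto intro!: powr_mono2)
      then have "x / 2 / exp (ln x powr a) \<le> real ?k / exp (ln (real ?k) powr a)"
        using k x3 by (intro frac_le) auto
      then show ?thesis by simp
    qed
    also have "\<dots> \<le> w ?k" using N[OF k(1)] k by (simp add: field_simps)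
    also have "\<dots> \<le> interp w x" using interp_bounds[OF w_mono, of x] x3 by simp
    finally show "x / exp (ln x powr a) / 4 \<le> interp w x" .
    have "interp w x \<le> w (Suc ?k)" using interp_bounds[OF w_mono, of x] x3 by simp
    also have "\<dots> \<le> 2 * (real (Suc ?k) / exp (ln (real (Suc ?k)) powr a))"
      using N[of "Suc ?k"] k by (simp add: field_simps)
    also have "\<dots> \<le> 4 * (x / exp (ln x powr a))"
    proof -
      have "exp (ln x powr a) \<le> exp (ln (real (Suc ?k)) powr a)"
        using k x3 a by (auto intro!: powr_mono2)
      then have "real (Suc ?k) / exp (ln (real (Suc ?k)) powr a) \<le> (2 * x) / exp (ln x powr a)"
        using k x3 by (intro frac_le) auto
      then have "2 * (real (Suc ?k) / exp (ln (real (Suc ?k)) powr a)) \<le> 2 * ((2 * x) / exp (ln x powr a))"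
        by (rule mult_left_mono) simp
      also have "\<dots> = 4 * (x / exp (ln x powr a))" by simp
      finally show ?thesis .
    qed
    finally show "interp w x \<le> 4 * (x / exp (ln x powr a))" .
  qed
  ultimately show ?thesis by (intro exI[of _ x0]) (auto simp: x0_def)
qed

text \<open>The function \<open>Q x = ln\<^bsup>1 - a\<^esup> x \<cdot> exp (ln\<^sup>a x)\<close> is an approximate primitive of
  \<open>exp (ln\<^sup>a x) / x\<close>: differentiating the exponential reproduces that integrand with the
  factor \<open>a\<close>, and differentiating the power of the logarithm adds a term of lower order.\<close>

lemma W_two_sided_bound:
  "\<exists>x0 c C. 1 \<le> ln x0 \<and> 0 < x0 \<and> 0 < c \<and> 0 < C \<and>
     (\<forall>x\<ge>x0. c * (ln x powr (1 - a) * exp (ln x powr a)) \<le> W w x \<and>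
        W w x \<le> C * (ln x powr (1 - a) * exp (ln x powr a)))"
proof -
  obtain x0 where x0: "1 \<le> ln x0" "0 < x0" and
    b: "\<And>x. x \<ge> x0 \<Longrightarrow> x / exp (ln x powr a) / 4 \<le> interp w x"
       "\<And>x. x \<ge> x0 \<Longrightarrow> interp w x \<le> 4 * (x / exp (ln x powr a))"
    using interp_two_sided_bound by blast
  define Q where "Q x = ln x powr (1 - a) * exp (ln x powr a)" for x
  define Q' where "Q' x = ((1 - a) * ln x powr (- a) + a) * (exp (ln x powr a) / x)" for x
  have ln1: "1 \<le> ln x" "0 < x" "1 < x" if "x \<ge> x0" for x
    using ln_ge_one_above[OF x0 that] by auto
  have Q: "(Q has_real_derivative Q' x) (at x)" if "x \<ge> x0" for x
  proof -
    have l: "0 < ln x" "0 < x" using ln1[OF that] by auto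
    have e: "ln x powr (1 - a) * (a * ln x powr (a - 1)) = a"
      using l by (simp add: mult.left_commute flip: powr_add)
    have "(Q has_real_derivative 
        ((1 - a) * ln x powr (- a)) * (1/x) * exp (ln x powr a)
        + ln x powr (1 - a) * (exp (ln x powr a) * (a * ln x powr (a - 1) * (1 / x)))) (at x)"
      unfolding Q_def[abs_def] using l by (auto intro!: derivative_eq_intros)
    also have "((1 - a) * ln x powr (- a)) * (1/x) * exp (ln x powr a)
        + ln x powr (1 - a) * (exp (ln x powr a) * (a * ln x powr (a - 1) * (1 / x)))
      = ((1 - a) * ln x powr (- a)) * (1/x) * exp (ln x powr a)
        + (ln x powr (1 - a) * (a * ln x powr (a - 1))) * (exp (ln x powr a) / x)"
      by simp
    also have "\<dots> = Q' x" unfolding e Q'_def by (simp add: algebra_simps add_divide_distrib)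
    finally show ?thesis .
  qed
  have Q'b: "a * (exp (ln x powr a) / x) \<le> Q' x" "Q' x \<le> exp (ln x powr a) / x" if "x \<ge> x0" for x
  proof -
    have "ln x powr (- a) \<le> 1" using ln1[OF that] a by (simp add: powr_minus inverse_le_1_iff ge_one_powr_ge_zero)
    then have le: "(1 - a) * ln x powr (- a) \<le> (1 - a) * 1" using a by (intro mult_left_mono) auto
    have "0 \<le> (1 - a) * ln x powr (- a)" using a by simp
    moreover have p: "0 \<le> exp (ln x powr a) / x" using ln1[OF that] by simp
    ultimately show "a * (exp (ln x powr a) / x) \<le> Q' x"
      unfolding Q'_def by (intro mult_right_mono) auto
    have "Q' x \<le> 1 * (exp (ln x powr a) / x)"
      unfolding Q'_def using le p by (intro mult_right_mono) auto
    then show "Q' x \<le> exp (ln x powr a) / x" by simp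
  qed
  have W': "(W w has_real_derivative 1 / interp w x) (at x)" if "x \<ge> x0" for x
    using W_has_derivative[of w x, OF w_pos w_mono] that x0 by simp
  have W'b: "1 / interp w x \<le> (4 / a) * Q' x" "(1/4) * Q' x \<le> 1 / interp w x" if "x \<ge> x0" for x
  proof -
    have p: "0 < x / exp (ln x powr a)" "0 < interp w x"
      using ln1[OF that] interp_pos[of w x, OF w_pos w_mono] by auto
    have "1 / interp w x \<le> 1 / (x / exp (ln x powr a) / 4)"
      using b[OF that] p by (intro frac_le) auto
    also have "\<dots> = (4 / a) * (a * (exp (ln x powr a) / x))" using a by simp
    also have "\<dots> \<le> (4 / a) * Q' x" using Q'b[OF that] a by (intro mult_left_mono) auto
    finally show "1 / interp w x \<le> (4 / a) * Q' x" .
    have "(1/4) * Q' x \<le> (1/4) * (exp (ln x powr a) / x)" using Q'b[OF that] by simp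
    also have "\<dots> = 1 / (4 * (x / exp (ln x powr a)))" by simp
    also have "\<dots> \<le> 1 / interp w x"
      using b[OF that] p by (intro frac_le) auto
    finally show "(1/4) * Q' x \<le> 1 / interp w x" .
  qed
  have pos: "Q x > 0" if "x \<ge> x0" for x
    using ln1[OF that] unfolding Q_def by simp
  have W0: "0 < W w x0" using W_strict_mono[of w 0 x0, OF w_pos w_mono] W_0[of w, OF w_pos w_mono] x0 by simp
  \<comment> \<open>The minimum and the maximum absorb the initial values at \<open>x0\<close>, so that the comparison of
    derivatives gives bounds without additive constants.\<close>
  define c where "c = min (W w x0 / Q x0) (1/4)"
  define C where "C = max (W w x0 / Q x0) (4/a)"
  have c: "0 < c" "c \<le> 1/4" "c * Q x0 \<le> W w x0" using W0 pos[of x0] by (auto simp: c_def min_def field_simps)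
  have C: "0 < C" "4/a \<le> C" "W w x0 \<le> C * Q x0" using W0 pos[of x0] a by (auto simp: C_def max_def field_simps)
  have "c * Q x \<le> W w x \<and> W w x \<le> C * Q x" if x: "x \<ge> x0" for x
  proof -
    have nn: "0 \<le> Q' z" if "z \<ge> x0" for z
      using order_trans[OF _ Q'b(1)[OF that]] a ln1[OF that] by simp
    have "c * Q x - c * Q x0 \<le> W w x - W w x0"
    proof (rule diff_le_of_deriv_le[OF x])
      fix z assume z: "x0 \<le> z"
      show "((\<lambda>z. c * Q z) has_real_derivative c * Q' z) (at z)" by (intro DERIV_cmult Q z)
      show "(W w has_real_derivative 1 / interp w z) (at z)" by (rule W'[OF z])
      show "c * Q' z \<le> 1 / interp w z"
        using mult_right_mono[OF c(2) nn[OF z]] W'b(2)[OF z] by linarith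
    qed
    moreover have "W w x - W w x0 \<le> C * Q x - C * Q x0"
    proof (rule diff_le_of_deriv_le[OF x])
      fix z assume z: "x0 \<le> z"
      show "((\<lambda>z. C * Q z) has_real_derivative C * Q' z) (at z)" by (intro DERIV_cmult Q z)
      show "(W w has_real_derivative 1 / interp w z) (at z)" by (rule W'[OF z])
      show "1 / interp w z \<le> C * Q' z"
        using mult_right_mono[OF C(2) nn[OF z]] W'b(1)[OF z] by linarith
    qed
    ultimately show ?thesis using c C by linarith
  qed
  then show ?thesis using x0 c C unfolding Q_def by blast
qed

lemma W_unbounded: "filterlim (W w) at_top at_top"
proof -
  obtain x0 c where c: "0 < c" and
    b: "\<And>x. x \<ge> x0 \<Longrightarrow> c * (ln x powr (1 - a) * exp (ln x powr a)) \<le> W w x"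
    using W_two_sided_bound by blast
  have "filterlim (\<lambda>x. c * (ln x powr (1 - a) * exp (ln x powr a))) at_top at_top"
    using a c by real_asymp
  then show ?thesis
    by (rule filterlim_at_top_mono) (use b in \<open>auto simp: eventually_at_top_linorder\<close>)
qed

text \<open>The derivative \<open>1 / (w x \<cdot> W x)\<close> of \<open>ln (W x)\<close> is comparable to \<open>1 / (x \<cdot> ln\<^bsup>1 - a\<^esup> x)\<close>,
  because the exponentials in the bounds for \<open>w\<close> and \<open>W\<close> cancel; up to the factor \<open>a\<close> this
  is the derivative of \<open>ln\<^sup>a x\<close>.\<close>

lemma ln_W_increments:
  "\<exists>x0 c C. 1 \<le> ln x0 \<and> 0 < x0 \<and> 0 < c \<and> 0 < C \<and>
     (\<forall>x y. x0 \<le> x \<longrightarrow> x \<le> y \<longrightarrow>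
        c * (ln y powr a - ln x powr a) \<le> ln (W w y) - ln (W w x) \<and>
        ln (W w y) - ln (W w x) \<le> C * (ln y powr a - ln x powr a))"
proof -
  obtain x1 where x1: "1 \<le> ln x1" "0 < x1" and
    b: "\<And>x. x \<ge> x1 \<Longrightarrow> x / exp (ln x powr a) / 4 \<le> interp w x"
       "\<And>x. x \<ge> x1 \<Longrightarrow> interp w x \<le> 4 * (x / exp (ln x powr a))"
    using interp_two_sided_bound by blast
  obtain x2 c C where x2: "1 \<le> ln x2" "0 < x2" and c: "0 < c" and C: "0 < C" and
    B: "\<And>x. x \<ge> x2 \<Longrightarrow> c * (ln x powr (1 - a) * exp (ln x powr a)) \<le> W w x"
       "\<And>x. x \<ge> x2 \<Longrightarrow> W w x \<le> C * (ln x powr (1 - a) * exp (ln x powr a))"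
    using W_two_sided_bound by blast
  define x0 where "x0 = max x1 x2"
  have x0: "1 \<le> ln x0" "0 < x0" using x1 x2 by (auto simp: x0_def max_def)
  have ln1: "1 \<le> ln x" "0 < x" "1 < x" if "x \<ge> x0" for x
    using ln_ge_one_above[OF x0 that] by auto
  define p where "p x = a * ln x powr (a - 1) * (1 / x)" for x
  have p: "((\<lambda>x. ln x powr a) has_real_derivative p x) (at x)" if "x \<ge> x0" for x
    using ln1[OF that] unfolding p_def by (auto intro!: derivative_eq_intros)
  have Wp: "0 < W w x" if "x \<ge> x0" for x
    using W_strict_mono[of w 0 x, OF w_pos w_mono] W_0[of w, OF w_pos w_mono] ln1[OF that] by simp
  have L: "((\<lambda>x. ln (W w x)) has_real_derivative (1 / interp w x) / W w x) (at x)" if "x \<ge> x0" for x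
    using W_has_derivative[of w x, OF w_pos w_mono] ln1[OF that] Wp[OF that]
    by (auto intro!: derivative_eq_intros)
  have key: "1 / (4 * C * a) * p x \<le> (1 / interp w x) / W w x \<and>
             (1 / interp w x) / W w x \<le> 4 / (c * a) * p x" if x: "x \<ge> x0" for x
  proof -
    define E where "E = exp (ln x powr a)"
    define T where "T = ln x powr (1 - a)"
    have pos: "0 < x" "0 < E" "0 < T" "0 < W w x" "0 < interp w x"
      using ln1[OF x] Wp[OF x] interp_pos[of w x, OF w_pos w_mono] by (auto simp: E_def T_def)
    have pT: "p x = a / (T * x)"
      using ln1[OF x] by (simp add: p_def T_def powr_diff field_simps)
    have bb: "x / E / 4 \<le> interp w x" "interp w x \<le> 4 * (x / E)"
         "c * (T * E) \<le> W w x" "W w x \<le> C * (T * E)"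
      using b[of x] B[of x] x by (auto simp: x0_def E_def T_def)
    have "interp w x * W w x \<le> (4 * (x / E)) * (C * (T * E))"
      using bb pos C by (intro mult_mono) auto
    also have "\<dots> = 4 * C * T * x" using pos by simp
    finally have "1 / (4 * C * T * x) \<le> 1 / (interp w x * W w x)"
      using pos C by (intro frac_le) auto
    moreover have "1 / (4 * C * a) * p x = 1 / (4 * C * T * x)"
      unfolding pT using a by (simp add: field_simps)
    moreover have "(x / E / 4) * (c * (T * E)) \<le> interp w x * W w x"
      using bb pos c by (intro mult_mono) auto
    then have "1 / (interp w x * W w x) \<le> 1 / ((x / E / 4) * (c * (T * E)))"
      using pos c by (intro frac_le) auto
    moreover have "1 / ((x / E / 4) * (c * (T * E))) = 4 / (c * a) * p x"
      unfolding pT using a pos by (simp add: field_simps)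
    ultimately show ?thesis by simp
  qed
  have "1 / (4 * C * a) * (ln y powr a - ln x powr a) \<le> ln (W w y) - ln (W w x) \<and>
        ln (W w y) - ln (W w x) \<le> 4 / (c * a) * (ln y powr a - ln x powr a)"
    if xy: "x0 \<le> x" "x \<le> y" for x y
  proof -
    have "1 / (4 * C * a) * ln y powr a - 1 / (4 * C * a) * ln x powr a \<le> ln (W w y) - ln (W w x)"
      by (rule diff_le_of_deriv_le[OF xy(2) DERIV_cmult[OF p] L]) (use key xy in auto)
    moreover have "ln (W w y) - ln (W w x) \<le> 4 / (c * a) * ln y powr a - 4 / (c * a) * ln x powr a"
      by (rule diff_le_of_deriv_le[OF xy(2) L DERIV_cmult[OF p]]) (use key xy in auto)
    ultimately show ?thesis by (simp add: right_diff_distrib)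
  qed
  moreover have "0 < 1 / (4 * C * a)" "0 < 4 / (c * a)" using a c C by auto
  ultimately show ?thesis using x0 by blast
qed

text \<open>With \<open>u = W x\<close> and \<open>v = W y\<close>, the increment of \<open>ln (w x)\<close> is
  \<open>(ln x - ln y) - (ln\<^sup>a x - ln\<^sup>a y)\<close> up to a constant. The first bracket is comparable to
  \<open>ln\<^bsup>1 - a\<^esup> x \<cdot> (ln\<^sup>a x - ln\<^sup>a y)\<close>, hence dominates the second, and \<open>ln\<^sup>a x - ln\<^sup>a y\<close> is
  comparable to \<open>ln u - ln v\<close>. Finally \<open>ln u\<close> is comparable to \<open>ln\<^sup>a x\<close>, which turns the
  factor \<open>ln\<^bsup>1 - a\<^esup> x\<close> into \<open>ln u\<close> to the power \<open>(1 - a) / a = 1/a - 1\<close>.\<close>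

lemma ln_interp_W_inv_increments:
  "\<exists>u0 c C K. 1 < u0 \<and> 0 < c \<and> 0 < C \<and>
     (\<forall>v u. u0 \<le> v \<longrightarrow> v \<le> u \<longrightarrow>
        c * ln u powr (1/a - 1) * (ln u - ln v) - K
          \<le> ln (interp w (W_inv w u)) - ln (interp w (W_inv w v)) \<and>
        ln (interp w (W_inv w u)) - ln (interp w (W_inv w v))
          \<le> C * ln u powr (1/a - 1) * (ln u - ln v) + K)"
proof -
  note W_facts = W_inv_W[OF w_pos w_mono W_unbounded] W_W_inv[OF w_pos w_mono W_unbounded]
    W_inv_nonneg[OF w_pos w_mono W_unbounded] W_inv_mono[OF w_pos w_mono W_unbounded]
  obtain x1 where x1: "1 \<le> ln x1" "0 < x1" and
    b: "\<And>x. x \<ge> x1 \<Longrightarrow> x / exp (ln x powr a) / 4 \<le> interp w x"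
       "\<And>x. x \<ge> x1 \<Longrightarrow> interp w x \<le> 4 * (x / exp (ln x powr a))"
    using interp_two_sided_bound by blast
  obtain x2 c C where x2: "1 \<le> ln x2" "0 < x2" and c: "0 < c" and C: "0 < C" and
    B: "\<And>x y. x \<ge> x2 \<Longrightarrow> x \<le> y \<Longrightarrow> c * (ln y powr a - ln x powr a) \<le> ln (W w y) - ln (W w x)"
       "\<And>x y. x \<ge> x2 \<Longrightarrow> x \<le> y \<Longrightarrow> ln (W w y) - ln (W w x) \<le> C * (ln y powr a - ln x powr a)"
    using ln_W_increments by blast
  have "eventually (\<lambda>x. W w x > 1) at_top" "eventually (\<lambda>x. ln x powr (1 - a) \<ge> 2) at_top"
    using W_unbounded filterlim_at_top_dense apply blast
    using a by real_asymp
  then have "eventually (\<lambda>x. W w x > 1 \<and> ln x powr (1 - a) \<ge> 2) at_top"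
    by eventually_elim auto
  then obtain x3 where x3: "\<And>x. x \<ge> x3 \<Longrightarrow> W w x > 1 \<and> ln x powr (1 - a) \<ge> 2"
    by (auto simp: eventually_at_top_linorder)
  define x0 where "x0 = max x1 (max x2 x3)"
  have x0: "1 \<le> ln x0" "0 < x0"
  proof -
    show "0 < x0" using x1 by (auto simp: x0_def)
    moreover have "x1 \<le> x0" by (simp add: x0_def)
    ultimately show "1 \<le> ln x0" using x1 ln_le_cancel_iff[of x1 x0] by linarith
  qed
  have ln1: "1 \<le> ln x" "0 < x" "1 < x" if "x \<ge> x0" for x
    using ln_ge_one_above[OF x0 that] by auto
  have x2_le: "x2 \<le> x0" by (simp add: x0_def)
  define s0 where "s0 = ln (W w x0)"
  \<comment> \<open>The lower bound \<open>2\<close> lets \<open>ln x - ln y\<close> absorb the subtracted increment of \<open>ln\<^sup>a\<close>,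
    keeping half of its size.\<close>
  have W1: "1 < W w x" "2 \<le> ln x powr (1 - a)" if "x \<ge> x0" for x
    using x3[of x] that by (auto simp: x0_def)
  have s0: "s0 > 0" using W1[of x0] by (simp add: s0_def)
  have q0: "0 < ln x0 powr a" using ln1[of x0] by simp
  define d where "d = min (s0 / ln x0 powr a) c"
  define D where "D = max (s0 / ln x0 powr a) C"
  have d: "0 < d" "d \<le> c" "d * ln x0 powr a \<le> s0" using s0 q0 c by (auto simp: d_def min_def field_simps)
  have D: "0 < D" "C \<le> D" "s0 \<le> D * ln x0 powr a" using s0 q0 C by (auto simp: D_def max_def field_simps)
  have sb: "d * ln x powr a \<le> ln (W w x)" "ln (W w x) \<le> D * ln x powr a" if x: "x \<ge> x0" for x
  proof -
    have m: "0 \<le> ln x powr a - ln x0 powr a" using ln1[OF x] ln1[of x0] x a by (auto intro!: powr_mono2)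
    show "d * ln x powr a \<le> ln (W w x)"
      using B(1)[OF x2_le x] mult_right_mono[OF d(2) m] d(3)
      unfolding s0_def[symmetric] right_diff_distrib by linarith
    show "ln (W w x) \<le> D * ln x powr a"
      using B(2)[OF x2_le x] mult_right_mono[OF D(2) m] D(3)
      unfolding s0_def[symmetric] right_diff_distrib by linarith
  qed
  define \<beta> where "\<beta> = 1/a - 1"
  have \<beta>: "0 < \<beta>" "a * \<beta> = 1 - a" using a by (auto simp: \<beta>_def field_simps)
  have sb\<beta>: "d powr \<beta> * ln x powr (1 - a) \<le> ln (W w x) powr \<beta>"
            "ln (W w x) powr \<beta> \<le> D powr \<beta> * ln x powr (1 - a)" if x: "x \<ge> x0" for x
  proof -
    have e: "(r * ln x powr a) powr \<beta> = r powr \<beta> * ln x powr (1 - a)" if "0 < r" for r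
      using that ln1[OF x] \<beta> by (simp add: powr_mult powr_powr)
    have Wp: "0 \<le> ln (W w x)" using W1[OF x] by simp
    show "d powr \<beta> * ln x powr (1 - a) \<le> ln (W w x) powr \<beta>"
      unfolding e[OF d(1), symmetric] using d \<beta> sb(1)[OF x] by (intro powr_mono2) auto
    show "ln (W w x) powr \<beta> \<le> D powr \<beta> * ln x powr (1 - a)"
      unfolding e[OF D(1), symmetric] using \<beta> sb(2)[OF x] Wp by (intro powr_mono2) auto
  qed
  have li: "\<bar>ln (interp w x) - (ln x - ln x powr a)\<bar> \<le> ln 4" if x: "x \<ge> x0" for x
  proof -
    have pos: "0 < x" "0 < interp w x" using ln1[OF x] interp_pos[of w x, OF w_pos w_mono] by auto
    have "ln (x / exp (ln x powr a) / 4) \<le> ln (interp w x)"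
      using b(1)[of x] x pos by (subst ln_le_cancel_iff) (auto simp: x0_def)
    moreover have "ln (interp w x) \<le> ln (4 * (x / exp (ln x powr a)))"
      using b(2)[of x] x pos by (subst ln_le_cancel_iff) (auto simp: x0_def)
    ultimately show ?thesis using pos by (simp add: ln_mult ln_div)
  qed
  define K where "K = 2 * ln (4::real)"
  have main: "(1 / (2 * C * D powr \<beta>)) * ln u powr \<beta> * (ln u - ln v) - K
          \<le> ln (interp w (W_inv w u)) - ln (interp w (W_inv w v)) \<and>
        ln (interp w (W_inv w u)) - ln (interp w (W_inv w v))
          \<le> (1 / (a * c * d powr \<beta>)) * ln u powr \<beta> * (ln u - ln v) + K"
    if uv: "W w x0 \<le> v" "v \<le> u" for u v
  proof -
    define x y where "x = W_inv w u" and "y = W_inv w v"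
    have v0: "0 \<le> v" using uv W1[of x0] by simp
    have xy: "x0 \<le> y" "y \<le> x" "W w x = u" "W w y = v"
      using W_facts(4)[of "W w x0" v] W_facts(4)[of v u] W_facts(1)[of x0] W_facts(2)[of u]
        W_facts(2)[of v] uv v0 x0 W1[of x0] by (auto simp: x_def y_def)
    then have xx: "x0 \<le> x" by simp
    define \<tau> where "\<tau> = ln x powr a - ln y powr a"
    define T where "T = ln x powr (1 - a)"
    have lxy: "0 < ln y" "ln y \<le> ln x" using ln1[OF xy(1)] ln1[OF xx] xy(2) by auto
    have \<tau>: "0 \<le> \<tau>" using lxy a unfolding \<tau>_def by (auto intro!: powr_mono2)
    have T: "T \<ge> 2" using W1[OF xx] by (simp add: T_def)
    have P: "T * \<tau> \<le> ln x - ln y" "ln x - ln y \<le> (1 / a) * (T * \<tau>)"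
      using powr_diff_bounds[OF a lxy] by (simp_all add: T_def \<tau>_def)
    have S: "c * \<tau> \<le> ln u - ln v" "ln u - ln v \<le> C * \<tau>"
      using B[of y x] xy x2_le unfolding \<tau>_def by auto
    have lu: "d powr \<beta> * T \<le> ln u powr \<beta>" "ln u powr \<beta> \<le> D powr \<beta> * T"
      using sb\<beta>[OF xx] xy by (simp_all add: T_def)
    have uvn: "0 \<le> ln u - ln v" using S(1) c \<tau> by (smt (verit) mult_nonneg_nonneg)
    have "ln u powr \<beta> * (ln u - ln v) \<le> (D powr \<beta> * T) * (C * \<tau>)"
      using lu S uvn T by (intro mult_mono) auto
    then have "(1 / (2 * C * D powr \<beta>)) * (ln u powr \<beta> * (ln u - ln v))
       \<le> (1 / (2 * C * D powr \<beta>)) * ((D powr \<beta> * T) * (C * \<tau>))"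
      using C D by (intro mult_left_mono) auto
    also have "\<dots> = T * \<tau> / 2" using C D by simp
    also have "\<dots> \<le> (ln x - ln y) - \<tau>"
      using P(1) mult_right_mono[OF T \<tau>] by linarith
    finally have 1: "(1 / (2 * C * D powr \<beta>)) * (ln u powr \<beta> * (ln u - ln v)) \<le> (ln x - ln y) - \<tau>" .
    have "(d powr \<beta> * T) * (c * \<tau>) \<le> ln u powr \<beta> * (ln u - ln v)"
      using lu S T c \<tau> by (intro mult_mono) auto
    then have "(1 / (a * c * d powr \<beta>)) * ((d powr \<beta> * T) * (c * \<tau>))
        \<le> (1 / (a * c * d powr \<beta>)) * (ln u powr \<beta> * (ln u - ln v))"
      using c d a by (intro mult_left_mono) auto
    moreover have "(1 / (a * c * d powr \<beta>)) * ((d powr \<beta> * T) * (c * \<tau>)) = (1 / a) * (T * \<tau>)"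
      using c d by simp
    ultimately have 2: "(ln x - ln y) - \<tau> \<le> (1 / (a * c * d powr \<beta>)) * (ln u powr \<beta> * (ln u - ln v))"
      using P(2) \<tau> by linarith
    have "\<bar>(ln (interp w x) - ln (interp w y)) - ((ln x - ln y) - \<tau>)\<bar> \<le> K"
      using li[OF xx] li[OF xy(1)] unfolding K_def \<tau>_def by linarith
    then show ?thesis using 1 2 unfolding x_def[symmetric] y_def[symmetric] mult.assoc by linarith
  qed
  show ?thesis
  proof (intro exI conjI)
    show "1 < W w x0" using W1[of x0] by simp
    show "0 < 1 / (2 * C * D powr \<beta>)" "0 < 1 / (a * c * d powr \<beta>)" using a c d C D by auto
  qed (use main in \<open>unfold \<beta>_def, blast\<close>)
qed

end

section \<open>Iterates of the operator on the logarithmic scale\<close>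

definition ratio_primitive :: "(real \<Rightarrow> real) \<Rightarrow> (real \<Rightarrow> real) \<Rightarrow> real \<Rightarrow> real" where
  "ratio_primitive H f x = (LINT u:{0..x}|lborel. H (f u) / H u)"

definition nonneg_continuous :: "(real \<Rightarrow> real) \<Rightarrow> bool" where
  "nonneg_continuous f \<longleftrightarrow> continuous_on {0..} f \<and> (\<forall>x\<ge>0. 0 \<le> f x)"

text \<open>The weight enters the analysis of the iterates only through the properties collected
  here, where \<open>H\<close> stands for \<open>w \<circ> W\<inverse>\<close>. The two estimates say that \<open>ln H\<close>, as a function of
  \<open>ln u\<close>, grows with slope of order \<open>ln\<^sup>\<beta> u\<close>.\<close>

locale log_power_rate =
  fixes H :: "real \<Rightarrow> real" and \<beta> u0 c C K :: real
  assumes H_cont: "continuous_on {0..} H"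
    and H_mono: "0 \<le> x \<Longrightarrow> x \<le> y \<Longrightarrow> H x \<le> H y"
    and H_pos: "0 \<le> x \<Longrightarrow> 0 < H x"
    and \<beta>: "0 < \<beta>" and u0: "1 < u0" and c: "0 < c" and C: "0 < C"
    and ln_H_lower: "u0 \<le> v \<Longrightarrow> v \<le> u \<Longrightarrow> c * ln u powr \<beta> * (ln u - ln v) - K \<le> ln (H u) - ln (H v)"
    and ln_H_upper: "u0 \<le> v \<Longrightarrow> v \<le> u \<Longrightarrow> ln (H u) - ln (H v) \<le> C * ln u powr \<beta> * (ln u - ln v) + K"
begin

abbreviation \<Gamma> where "\<Gamma> \<equiv> ratio_primitive H"

lemma continuous_on_ratio:
  assumes "nonneg_continuous f"
  shows "continuous_on {0..} (\<lambda>u. H (f u) / H u)"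
proof -
  have f: "continuous_on {0..} f" "f ` {0..} \<subseteq> {0..}"
    using assms by (auto simp: nonneg_continuous_def)
  have "continuous_on {0..} (\<lambda>u. H (f u))"
    using continuous_on_compose2[OF H_cont f] .
  then show ?thesis
    by (rule continuous_on_divide[OF _ H_cont]) (use H_pos in force)
qed

lemma ratio_pos: "nonneg_continuous f \<Longrightarrow> 0 \<le> u \<Longrightarrow> 0 < H (f u) / H u"
  using H_pos by (simp add: nonneg_continuous_def)

lemma \<Gamma>_has_derivative:
  assumes "nonneg_continuous f" "0 < x"
  shows "(\<Gamma> f has_real_derivative H (f x) / H x) (at x)"
  using primitive_has_derivative_at[OF continuous_on_ratio[OF assms(1)] assms(2)]
  unfolding ratio_primitive_def[abs_def] .

lemma \<Gamma>_eq_integral: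
  assumes "nonneg_continuous f" "0 \<le> x"
  shows "\<Gamma> f x = integral {0..x} (\<lambda>u. H (f u) / H u)"
  unfolding ratio_primitive_def by (rule primitive_eq_integral[OF continuous_on_ratio[OF assms(1)] assms(2)])

lemma ratio_integrable:
  assumes "nonneg_continuous f"
  shows "(\<lambda>u. H (f u) / H u) integrable_on {0..x}"
  by (rule integrable_continuous_interval) (rule continuous_on_subset[OF continuous_on_ratio[OF assms]], auto)

lemma nonneg_continuous_\<Gamma>:
  assumes "nonneg_continuous f"
  shows "nonneg_continuous (\<Gamma> f)"
  unfolding nonneg_continuous_def
proof (intro conjI allI impI)
  show "continuous_on {0..} (\<Gamma> f)"
    using continuous_on_primitive[OF continuous_on_ratio[OF assms]] unfolding ratio_primitive_def[abs_def] .
  fix x :: real assume x: "0 \<le> x"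
  show "0 \<le> \<Gamma> f x"
    unfolding \<Gamma>_eq_integral[OF assms x]
    by (intro integral_nonneg ratio_integrable assms) (use ratio_pos[OF assms] in \<open>auto intro: less_imp_le\<close>)
qed

lemma \<Gamma>_mono:
  assumes "nonneg_continuous f" "nonneg_continuous g" "\<And>x. 0 \<le> x \<Longrightarrow> f x \<le> g x" "0 \<le> x"
  shows "\<Gamma> f x \<le> \<Gamma> g x"
  unfolding \<Gamma>_eq_integral[OF assms(1,4)] \<Gamma>_eq_integral[OF assms(2,4)]
proof (intro integral_le ratio_integrable assms(1,2))
  fix u assume "u \<in> {0..x}"
  then have u: "0 \<le> u" "0 \<le> f u" using assms(1) by (auto simp: nonneg_continuous_def)
  show "H (f u) / H u \<le> H (g u) / H u"
    using H_mono[OF u(2) assms(3)[OF u(1)]] H_pos[OF u(1)] by (simp add: divide_right_mono)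
qed

text \<open>By monotonicity \<open>f u\<close> may be replaced by its bound, raised to \<open>u0\<close> where it is too small
  for the lower estimate on \<open>ln H\<close>. In both cases the logarithmic distance to \<open>u\<close> is at
  least a multiple of \<open>ln\<^sup>\<gamma> u\<close>: this is where \<open>\<gamma> \<le> 1\<close> is used.\<close>

lemma ratio_upper_bound:
  assumes f: "nonneg_continuous f" and \<gamma>: "0 \<le> \<gamma>" "\<gamma> \<le> 1" and d: "0 < d"
    and ev: "eventually (\<lambda>u. f u \<le> u * exp (- d * ln u powr \<gamma>)) at_top"
  shows "\<exists>d' K'. 0 < d' \<and> 0 < K' \<and>
    eventually (\<lambda>u. H (f u) / H u \<le> K' * exp (- d' * ln u powr (\<gamma> + \<beta>))) at_top"
proof (intro exI conjI)
  show "0 < c * min d (1/2)" using c d by simp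
  show "0 < exp K" by simp
  have "eventually (\<lambda>u::real. ln u0 \<le> ln u / 2) at_top" "eventually (\<lambda>u::real. ln u \<ge> 1) at_top"
    by real_asymp+
  with ev eventually_ge_at_top[of u0] show "eventually (\<lambda>u. H (f u) / H u \<le> exp K * exp (- (c * min d (1/2)) * ln u powr (\<gamma> + \<beta>))) at_top"
  proof eventually_elim
    case (elim u)
    define v where "v = max (u * exp (- d * ln u powr \<gamma>)) u0"
    have u: "0 < u" "0 \<le> f u" using elim u0 f by (auto simp: nonneg_continuous_def)
    have v: "u0 \<le> v" "f u \<le> v" "v \<le> u" "0 < v"
      using elim d u u0 by (auto simp: v_def)
    have lv: "min d (1/2) * ln u powr \<gamma> \<le> ln u - ln v"
    proof (cases "u * exp (- d * ln u powr \<gamma>) \<ge> u0")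
      case True
      then have "ln v = ln u - d * ln u powr \<gamma>" using u by (simp add: v_def max_def ln_mult)
      then show ?thesis using mult_right_mono[of "min d (1/2)" d "ln u powr \<gamma>"] by simp
    next
      case False
      then have "ln v = ln u0" by (simp add: v_def)
      moreover have "ln u powr \<gamma> \<le> ln u powr 1" using elim \<gamma> by (intro powr_mono) auto
      then have "min d (1/2) * ln u powr \<gamma> \<le> (1/2) * ln u" using elim d by (intro mult_mono) auto
      ultimately show ?thesis using elim by linarith
    qed
    have "(c * min d (1/2)) * ln u powr (\<gamma> + \<beta>) = c * ln u powr \<beta> * (min d (1/2) * ln u powr \<gamma>)"
      by (simp add: powr_add)
    also have "\<dots> \<le> c * ln u powr \<beta> * (ln u - ln v)"
      using lv c by (intro mult_left_mono) auto
    also have "\<dots> \<le> ln (H u) - ln (H v) + K" using ln_H_lower[OF v(1,3)] by simp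
    also have "\<dots> \<le> ln (H u) - ln (H (f u)) + K"
      using H_mono[OF u(2) v(2)] H_pos[OF u(2)] H_pos[of v] v(4) by simp
    finally have "ln (H (f u)) - ln (H u) \<le> K + - (c * min d (1/2)) * ln u powr (\<gamma> + \<beta>)" by simp
    then have "exp (ln (H (f u)) - ln (H u)) \<le> exp (K + - (c * min d (1/2)) * ln u powr (\<gamma> + \<beta>))"
      by (subst exp_le_cancel_iff)
    moreover have "exp (ln (H (f u)) - ln (H u)) = H (f u) / H u"
      using H_pos[OF u(2)] H_pos[of u] u(1) by (simp add: exp_diff)
    ultimately show ?case by (simp only: exp_add)
  qed
qed

text \<open>As \<open>\<gamma> < 1\<close>, the lower bound for \<open>f u\<close> tends to infinity, so that it eventually exceeds
  \<open>u0\<close> and the upper estimate on \<open>ln H\<close> applies to it.\<close>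

lemma ratio_lower_bound:
  assumes f: "nonneg_continuous f" and \<gamma>: "0 \<le> \<gamma>" "\<gamma> < 1" and d: "0 < d"
    and ev: "eventually (\<lambda>u. u * exp (- d * ln u powr \<gamma>) \<le> f u) at_top"
  shows "\<exists>d' K'. 0 < d' \<and> 0 < K' \<and>
    eventually (\<lambda>u. K' * exp (- d' * ln u powr (\<gamma> + \<beta>)) \<le> H (f u) / H u) at_top"
proof (intro exI conjI)
  show "0 < C * d" using C d by simp
  show "0 < exp (- K)" by simp
  have "eventually (\<lambda>u::real. ln u0 \<le> ln u - d * ln u powr \<gamma>) at_top" using \<gamma> d by real_asymp
  moreover have "eventually (\<lambda>u::real. ln u \<ge> 1) at_top" by real_asymp
  ultimately show "eventually (\<lambda>u. exp (- K) * exp (- (C * d) * ln u powr (\<gamma> + \<beta>)) \<le> H (f u) / H u) at_top"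
    using ev eventually_ge_at_top[of u0]
  proof eventually_elim
    case (elim u)
    define v where "v = u * exp (- d * ln u powr \<gamma>)"
    have u: "0 < u" "0 \<le> f u" using elim u0 f by (auto simp: nonneg_continuous_def)
    have lv: "ln v = ln u - d * ln u powr \<gamma>" using u by (simp add: v_def ln_mult)
    have v0: "0 < v" using u by (simp add: v_def)
    have v: "u0 \<le> v" "v \<le> f u" "v \<le> u"
      using elim d u u0 lv v0 ln_le_cancel_iff[of u0 v] by (auto simp: v_def)
    have "ln (H u) - ln (H (f u)) \<le> ln (H u) - ln (H v)"
      using H_mono[OF less_imp_le[OF v0] v(2)] H_pos[OF u(2)] H_pos[of v] v0 by simp
    also have "\<dots> \<le> C * ln u powr \<beta> * (ln u - ln v) + K" by (rule ln_H_upper[OF v(1,3)])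
    also have "\<dots> = C * d * ln u powr (\<gamma> + \<beta>) + K" unfolding lv by (simp add: powr_add)
    finally have "- K + - (C * d) * ln u powr (\<gamma> + \<beta>) \<le> ln (H (f u)) - ln (H u)" by simp
    then have "exp (- K + - (C * d) * ln u powr (\<gamma> + \<beta>)) \<le> exp (ln (H (f u)) - ln (H u))"
      by (subst exp_le_cancel_iff)
    moreover have "exp (ln (H (f u)) - ln (H u)) = H (f u) / H u"
      using H_pos[OF u(2)] H_pos[of u] u(1) by (simp add: exp_diff)
    ultimately show ?case by (simp only: exp_add)
  qed
qed

text \<open>For \<open>\<delta> > 1\<close> the integrand decays faster than every power of \<open>u\<close>, in particular faster
  than \<open>1 / u\<^sup>2\<close>.\<close>

lemma bounded_\<Gamma>:
  assumes f: "nonneg_continuous f" and \<delta>: "1 < \<delta>" and d: "0 < d" and K': "0 < K'"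
    and ev: "eventually (\<lambda>u. H (f u) / H u \<le> K' * exp (- d * ln u powr \<delta>)) at_top"
  shows "bounded (\<Gamma> f ` {0..})"
proof -
  have "eventually (\<lambda>x::real. K' * exp (- d * ln x powr \<delta>) \<le> 1 / x^2) at_top"
    using \<delta> d K' by real_asymp
  with ev have "eventually (\<lambda>u. H (f u) / H u \<le> 1 / u^2) at_top"
    by eventually_elim linarith
  then obtain u1 where u1: "\<And>u. u1 \<le> u \<Longrightarrow> H (f u) / H u \<le> 1 / u^2"
    by (auto simp: eventually_at_top_linorder)
  define b where "b = max u1 1"
  have b: "1 \<le> b" "u1 \<le> b" by (auto simp: b_def)
  note \<Gamma>f = nonneg_continuous_\<Gamma>[OF f]
  have "bounded (\<Gamma> f ` {0..b})"
    by (intro compact_imp_bounded compact_continuous_image)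
       (use \<Gamma>f in \<open>auto simp: nonneg_continuous_def intro: continuous_on_subset\<close>)
  moreover have "\<Gamma> f ` {b..} \<subseteq> {0..\<Gamma> f b + 1}"
  proof
    fix y assume "y \<in> \<Gamma> f ` {b..}"
    then obtain x where x: "b \<le> x" "y = \<Gamma> f x" by auto
    have "\<Gamma> f x - \<Gamma> f b \<le> - (1 / x) - - (1 / b)"
    proof (rule diff_le_of_deriv_le[OF x(1)])
      fix z assume z: "b \<le> z"
      show "(\<Gamma> f has_real_derivative H (f z) / H z) (at z)" using \<Gamma>_has_derivative[OF f, of z] z b by simp
      show "((\<lambda>z. - (1 / z)) has_real_derivative 1 / z^2) (at z)"
        using z b by (auto intro!: derivative_eq_intros simp: power2_eq_square)
      show "H (f z) / H z \<le> 1 / z^2" using u1[of z] z b by simp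
    qed
    moreover have "1 / b \<le> 1" "0 \<le> 1 / x" using b x by auto
    moreover have "0 \<le> \<Gamma> f x" using \<Gamma>f x b by (simp add: nonneg_continuous_def)
    ultimately have "0 \<le> \<Gamma> f x" "\<Gamma> f x \<le> \<Gamma> f b + 1" by linarith+
    then show "y \<in> {0..\<Gamma> f b + 1}" using x by simp
  qed
  then have "bounded (\<Gamma> f ` {b..})" by (rule bounded_subset[OF bounded_closed_interval])
  ultimately have "bounded (\<Gamma> f ` {0..b} \<union> \<Gamma> f ` {b..})" by simp
  moreover have "\<Gamma> f ` {0..} \<subseteq> \<Gamma> f ` {0..b} \<union> \<Gamma> f ` {b..}" by force
  ultimately show ?thesis by (rule bounded_subset)
qed

text \<open>The majorant \<open>F\<close> is \<open>2 \<cdot> K' \<cdot> x \<cdot> exp (- 2 \<cdot> e \<cdot> ln\<^sup>\<delta> x)\<close>; its derivative dominates the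
  integrand for \<open>x \<ge> b\<close> because \<open>2 \<cdot> e \<le> d\<close> and \<open>2 \<cdot> e \<le> 1/2\<close>. Halving the constant in the
  exponent then pays for the factor \<open>2 \<cdot> K'\<close> and for the initial value of the primitive.\<close>

lemma \<Gamma>_upper_bound:
  assumes f: "nonneg_continuous f" and \<delta>: "0 < \<delta>" "\<delta> \<le> 1" and d: "0 < d" and K': "0 < K'"
    and ev: "eventually (\<lambda>u. H (f u) / H u \<le> K' * exp (- d * ln u powr \<delta>)) at_top"
  shows "\<exists>d'. 0 < d' \<and> eventually (\<lambda>x. \<Gamma> f x \<le> x * exp (- d' * ln x powr \<delta>)) at_top"
proof -
  define e where "e = min d (1/2) / 2"
  have e: "0 < e" "2 * e \<le> d" "e \<le> 1/4" "e < 1" using d by (auto simp: e_def)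
  have "eventually (\<lambda>x::real. 1 \<le> ln x) at_top" by real_asymp
  with ev have "eventually (\<lambda>u. H (f u) / H u \<le> K' * exp (- d * ln u powr \<delta>) \<and> 1 \<le> ln u) at_top"
    by eventually_elim auto
  then obtain u1 where u1: "\<And>u. u1 \<le> u \<Longrightarrow> H (f u) / H u \<le> K' * exp (- d * ln u powr \<delta>) \<and> 1 \<le> ln u"
    by (auto simp: eventually_at_top_linorder)
  define b where "b = max u1 1"
  have b: "1 \<le> ln b" "0 < b" "u1 \<le> b" using u1[of b] by (auto simp: b_def)
  define F where "F x = 2 * K' * (x * exp (- (2 * e) * ln x powr \<delta>))" for x
  have bd: "\<Gamma> f x \<le> \<Gamma> f b + F x" if x: "b \<le> x" for x
  proof -
    have "\<Gamma> f x - \<Gamma> f b \<le> F x - F b"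
    proof (rule diff_le_of_deriv_le[OF x])
      fix z assume z: "b \<le> z"
      note z1 = ln_ge_one_above[OF b(1,2) z]
      show "(\<Gamma> f has_real_derivative H (f z) / H z) (at z)" using \<Gamma>_has_derivative[OF f, of z] z1 by simp
      show "(F has_real_derivative 2 * K' * ((1 - (2 * e) * \<delta> * ln z powr (\<delta> - 1)) * exp (- (2 * e) * ln z powr \<delta>))) (at z)"
        unfolding F_def[abs_def] by (rule DERIV_cmult[OF x_exp_has_derivative[OF z1(2)]])
      have "ln z powr (\<delta> - 1) \<le> ln z powr 0" using z1 \<delta> by (intro powr_mono) auto
      then have "(2 * e) * \<delta> * ln z powr (\<delta> - 1) \<le> (1/2) * 1 * 1"
        using e \<delta> z1 by (intro mult_mono) auto
      then have "1 / 2 \<le> 1 - (2 * e) * \<delta> * ln z powr (\<delta> - 1)" by simp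
      then have "(1/2) * exp (- (2 * e) * ln z powr \<delta>) \<le>
         (1 - (2 * e) * \<delta> * ln z powr (\<delta> - 1)) * exp (- (2 * e) * ln z powr \<delta>)"
        by (rule mult_right_mono) simp
      then have 1: "2 * K' * ((1/2) * exp (- (2 * e) * ln z powr \<delta>)) \<le>
         2 * K' * ((1 - (2 * e) * \<delta> * ln z powr (\<delta> - 1)) * exp (- (2 * e) * ln z powr \<delta>))"
        using K' by (intro mult_left_mono) auto
      have "exp (- d * ln z powr \<delta>) \<le> exp (- (2 * e) * ln z powr \<delta>)"
        using e by (simp add: mult_right_mono)
      then have "K' * exp (- d * ln z powr \<delta>) \<le> K' * exp (- (2 * e) * ln z powr \<delta>)"
        using K' by (intro mult_left_mono) auto
      then show "H (f z) / H z \<le> 2 * K' * ((1 - (2 * e) * \<delta> * ln z powr (\<delta> - 1)) * exp (- (2 * e) * ln z powr \<delta>))"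
        using u1[of z] z b 1 by simp
    qed
    moreover have "0 \<le> F b" using K' b by (simp add: F_def)
    ultimately show ?thesis by linarith
  qed
  have "filterlim (\<lambda>x. x * exp (- e * ln x powr \<delta>)) at_top at_top"
    by (rule filterlim_x_exp_neg_ln_powr) (use \<delta> e in auto)
  then have "eventually (\<lambda>x::real. 2 * \<Gamma> f b \<le> x * exp (- e * ln x powr \<delta>)) at_top"
    by (simp add: filterlim_at_top)
  moreover have "eventually (\<lambda>x. exp (- e * ln x powr \<delta>) \<le> 1 / (4 * K')) at_top"
    by (rule eventually_exp_neg_ln_powr_le) (use e \<delta> K' in auto)
  ultimately have "eventually (\<lambda>x. \<Gamma> f x \<le> x * exp (- e * ln x powr \<delta>)) at_top"
    using eventually_ge_at_top[of b]
  proof eventually_elim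
    case (elim x)
    have "2 * K' * exp (- (2 * e) * ln x powr \<delta>)
        = 2 * K' * exp (- e * ln x powr \<delta>) * exp (- e * ln x powr \<delta>)"
      by (simp flip: exp_add)
    also have "\<dots> \<le> 2 * K' * (1 / (4 * K')) * exp (- e * ln x powr \<delta>)"
      using elim K' by (intro mult_right_mono mult_left_mono) auto
    also have "\<dots> = exp (- e * ln x powr \<delta>) / 2" using K' by simp
    finally have half: "2 * K' * exp (- (2 * e) * ln x powr \<delta>) \<le> exp (- e * ln x powr \<delta>) / 2" .
    have "F x = x * (2 * K' * exp (- (2 * e) * ln x powr \<delta>))" by (simp add: F_def)
    also have "\<dots> \<le> x * (exp (- e * ln x powr \<delta>) / 2)" using half elim b by (intro mult_left_mono) auto
    finally show ?case using bd[of x] elim by simp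
  qed
  with e show ?thesis by blast
qed

text \<open>Now \<open>K' \<cdot> x \<cdot> exp (- d \<cdot> ln\<^sup>\<delta> x)\<close> is a minorant, and doubling the constant in the
  exponent pays for the factor \<open>K'\<close> and the initial value.\<close>

lemma \<Gamma>_lower_bound:
  assumes f: "nonneg_continuous f" and \<delta>: "0 < \<delta>" "\<delta> < 1" and d: "0 < d" and K': "0 < K'"
    and ev: "eventually (\<lambda>u. K' * exp (- d * ln u powr \<delta>) \<le> H (f u) / H u) at_top"
  shows "\<exists>d'. 0 < d' \<and> eventually (\<lambda>x. x * exp (- d' * ln x powr \<delta>) \<le> \<Gamma> f x) at_top"
proof -
  have "eventually (\<lambda>x::real. 1 \<le> ln x) at_top" by real_asymp
  with ev have "eventually (\<lambda>u. K' * exp (- d * ln u powr \<delta>) \<le> H (f u) / H u \<and> 1 \<le> ln u) at_top"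
    by eventually_elim auto
  then obtain u1 where u1: "\<And>u. u1 \<le> u \<Longrightarrow> K' * exp (- d * ln u powr \<delta>) \<le> H (f u) / H u \<and> 1 \<le> ln u"
    by (auto simp: eventually_at_top_linorder)
  define b where "b = max u1 1"
  have b: "1 \<le> ln b" "0 < b" "u1 \<le> b" using u1[of b] by (auto simp: b_def)
  define F where "F x = K' * (x * exp (- d * ln x powr \<delta>))" for x
  have bd: "F x - F b \<le> \<Gamma> f x" if x: "b \<le> x" for x
  proof -
    have "F x - F b \<le> \<Gamma> f x - \<Gamma> f b"
    proof (rule diff_le_of_deriv_le[OF x])
      fix z assume z: "b \<le> z"
      note z1 = ln_ge_one_above[OF b(1,2) z]
      show "(\<Gamma> f has_real_derivative H (f z) / H z) (at z)" using \<Gamma>_has_derivative[OF f, of z] z1 by simp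
      show "(F has_real_derivative K' * ((1 - d * \<delta> * ln z powr (\<delta> - 1)) * exp (- d * ln z powr \<delta>))) (at z)"
        unfolding F_def[abs_def] by (rule DERIV_cmult[OF x_exp_has_derivative[OF z1(2)]])
      have "1 - d * \<delta> * ln z powr (\<delta> - 1) \<le> 1" using d \<delta> by simp
      then have "(1 - d * \<delta> * ln z powr (\<delta> - 1)) * exp (- d * ln z powr \<delta>) \<le> 1 * exp (- d * ln z powr \<delta>)"
        by (rule mult_right_mono) simp
      then have "K' * ((1 - d * \<delta> * ln z powr (\<delta> - 1)) * exp (- d * ln z powr \<delta>)) \<le> K' * exp (- d * ln z powr \<delta>)"
        using K' by simp
      then show "K' * ((1 - d * \<delta> * ln z powr (\<delta> - 1)) * exp (- d * ln z powr \<delta>)) \<le> H (f z) / H z"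
        using u1[of z] z b by simp
    qed
    moreover have "0 \<le> \<Gamma> f b" using nonneg_continuous_\<Gamma>[OF f] b by (simp add: nonneg_continuous_def)
    ultimately show ?thesis by linarith
  qed
  have "filterlim (\<lambda>x. x * exp (- d * ln x powr \<delta>)) at_top at_top"
    by (rule filterlim_x_exp_neg_ln_powr) (use \<delta> d in auto)
  then have "eventually (\<lambda>x::real. 2 * F b / K' \<le> x * exp (- d * ln x powr \<delta>)) at_top"
    by (simp add: filterlim_at_top)
  moreover have "eventually (\<lambda>x. exp (- d * ln x powr \<delta>) \<le> K' / 2) at_top"
    by (rule eventually_exp_neg_ln_powr_le) (use d \<delta> K' in auto)
  ultimately have "eventually (\<lambda>x. x * exp (- (2 * d) * ln x powr \<delta>) \<le> \<Gamma> f x) at_top"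
    using eventually_ge_at_top[of b]
  proof eventually_elim
    case (elim x)
    have "exp (- (2 * d) * ln x powr \<delta>) = exp (- d * ln x powr \<delta>) * exp (- d * ln x powr \<delta>)"
      by (simp flip: exp_add)
    also have "\<dots> \<le> K' / 2 * exp (- d * ln x powr \<delta>)"
      using elim by (intro mult_right_mono) auto
    finally have "x * exp (- (2 * d) * ln x powr \<delta>) \<le> x * (K' / 2 * exp (- d * ln x powr \<delta>))"
      using elim b by (intro mult_left_mono) auto
    also have "\<dots> = F x / 2" by (simp add: F_def)
    also have "F b \<le> F x / 2" using elim K' by (simp add: F_def field_simps)
    then have "F x / 2 \<le> \<Gamma> f x" using bd[of x] elim by linarith
    finally show ?case .
  qed
  moreover have "0 < 2 * d" using d by simp
  ultimately show ?thesis by blast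
qed

abbreviation "iter \<eta> k \<equiv> (\<Gamma> ^^ k) (\<lambda>x. \<eta> * x)"

lemma nonneg_continuous_iter: "0 \<le> \<eta> \<Longrightarrow> nonneg_continuous (iter \<eta> k)"
proof (induction k)
  case 0
  then show ?case by (auto simp: nonneg_continuous_def intro!: continuous_intros)
qed (simp add: nonneg_continuous_\<Gamma>)

lemma iter_mono:
  assumes "0 \<le> \<eta>" "\<eta> \<le> \<eta>'" "0 \<le> x"
  shows "iter \<eta> k x \<le> iter \<eta>' k x"
  using assms(3)
proof (induction k arbitrary: x)
  case 0
  then show ?case using assms by (simp add: mult_right_mono)
next
  case (Suc k)
  then show ?case using assms by (simp add: \<Gamma>_mono nonneg_continuous_iter)
qed

lemma bounded_iter_mono:
  assumes "0 \<le> \<eta>" "\<eta> \<le> \<eta>'" "bounded (iter \<eta>' k ` {0..})"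
  shows "bounded (iter \<eta> k ` {0..})"
proof -
  obtain B where "\<And>x. 0 \<le> x \<Longrightarrow> \<bar>iter \<eta>' k x\<bar> \<le> B"
    using assms(3) by (auto simp: bounded_iff)
  then have "\<bar>iter \<eta> k x\<bar> \<le> B" if "0 \<le> x" for x
    using iter_mono[OF assms(1,2) that, of k] nonneg_continuous_iter[OF assms(1), of k] that
    by (fastforce simp: nonneg_continuous_def)
  then show ?thesis by (auto simp: bounded_iff)
qed

text \<open>Each application of \<open>\<Gamma>\<close> raises the exponent of the logarithm by \<open>\<beta>\<close>, starting from
  \<open>\<eta> \<cdot> u = u \<cdot> exp (ln \<eta> \<cdot> ln\<^sup>0 u)\<close>. The value \<open>k \<cdot> \<beta> = 1\<close> is included, so that the next
  iterate is bounded also in the critical case.\<close>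

lemma iter_upper_bound:
  assumes \<eta>: "0 < \<eta>" "\<eta> < 1" and k: "real k * \<beta> \<le> 1"
  shows "\<exists>d. 0 < d \<and> eventually (\<lambda>u. iter \<eta> k u \<le> u * exp (- d * ln u powr (real k * \<beta>))) at_top"
  using k
proof (induction k)
  case 0
  have "eventually (\<lambda>u::real. ln u \<ge> 1) at_top" by real_asymp
  then have "eventually (\<lambda>u. iter \<eta> 0 u \<le> u * exp (- (- ln \<eta>) * ln u powr (real 0 * \<beta>))) at_top"
    by eventually_elim (use \<eta> in simp)
  moreover have "0 < - ln \<eta>" using \<eta> by simp
  ultimately show ?case by blast
next
  case (Suc k)
  have le: "real k * \<beta> \<le> 1" "0 \<le> real k * \<beta>" and e: "real k * \<beta> + \<beta> = real (Suc k) * \<beta>"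
    using Suc.prems \<beta> by (auto simp: algebra_simps)
  obtain d where d: "0 < d" "eventually (\<lambda>u. iter \<eta> k u \<le> u * exp (- d * ln u powr (real k * \<beta>))) at_top"
    using Suc.IH[OF le(1)] by blast
  note f = nonneg_continuous_iter[OF less_imp_le[OF \<eta>(1)], of k]
  obtain d' K' where d': "0 < d'" "0 < K'"
     "eventually (\<lambda>u. H (iter \<eta> k u) / H u \<le> K' * exp (- d' * ln u powr (real (Suc k) * \<beta>))) at_top"
    using ratio_upper_bound[OF f le(2,1) d] unfolding e by blast
  have "0 < real (Suc k) * \<beta>" using \<beta> by simp
  from \<Gamma>_upper_bound[OF f this Suc.prems d'] show ?case by simp
qed

lemma iter_lower_bound:
  assumes \<eta>: "0 < \<eta>" "\<eta> < 1" and k: "real k * \<beta> < 1"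
  shows "\<exists>d. 0 < d \<and> eventually (\<lambda>u. u * exp (- d * ln u powr (real k * \<beta>)) \<le> iter \<eta> k u) at_top"
  using k
proof (induction k)
  case 0
  have "eventually (\<lambda>u::real. ln u \<ge> 1) at_top" by real_asymp
  then have "eventually (\<lambda>u. u * exp (- (- ln \<eta>) * ln u powr (real 0 * \<beta>)) \<le> iter \<eta> 0 u) at_top"
    by eventually_elim (use \<eta> in simp)
  moreover have "0 < - ln \<eta>" using \<eta> by simp
  ultimately show ?case by blast
next
  case (Suc k)
  have le: "real k * \<beta> < 1" "0 \<le> real k * \<beta>" and e: "real k * \<beta> + \<beta> = real (Suc k) * \<beta>"
    using Suc.prems \<beta> by (auto simp: algebra_simps)
  obtain d where d: "0 < d" "eventually (\<lambda>u. u * exp (- d * ln u powr (real k * \<beta>)) \<le> iter \<eta> k u) at_top"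
    using Suc.IH[OF le(1)] by blast
  note f = nonneg_continuous_iter[OF less_imp_le[OF \<eta>(1)], of k]
  obtain d' K' where d': "0 < d'" "0 < K'"
     "eventually (\<lambda>u. K' * exp (- d' * ln u powr (real (Suc k) * \<beta>)) \<le> H (iter \<eta> k u) / H u) at_top"
    using ratio_lower_bound[OF f le(2,1) d] unfolding e by blast
  have "0 < real (Suc k) * \<beta>" using \<beta> by simp
  from \<Gamma>_lower_bound[OF f this Suc.prems d'] show ?case by simp
qed

lemma bounded_iter:
  assumes \<eta>: "0 < \<eta>" "\<eta> < 1" and k: "real k * \<beta> \<le> 1" "1 < real (Suc k) * \<beta>"
  shows "bounded (iter \<eta> (Suc k) ` {0..})"
proof -
  note f = nonneg_continuous_iter[OF less_imp_le[OF \<eta>(1)], of k]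
  obtain d where d: "0 < d" "eventually (\<lambda>u. iter \<eta> k u \<le> u * exp (- d * ln u powr (real k * \<beta>))) at_top"
    using iter_upper_bound[OF \<eta> k(1)] by blast
  have e: "0 \<le> real k * \<beta>" "real k * \<beta> + \<beta> = real (Suc k) * \<beta>" using \<beta> by (auto simp: algebra_simps)
  obtain d' K' where d': "0 < d'" "0 < K'"
     "eventually (\<lambda>u. H (iter \<eta> k u) / H u \<le> K' * exp (- d' * ln u powr (real (Suc k) * \<beta>))) at_top"
    using ratio_upper_bound[OF f e(1) k(1) d] unfolding e by blast
  from bounded_\<Gamma>[OF f k(2) d'] show ?thesis by simp
qed

lemma unbounded_iter:
  assumes \<eta>: "0 < \<eta>" "\<eta> < 1" and k: "real k * \<beta> < 1"
  shows "\<not> bounded (iter \<eta> k ` {0..})"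
proof
  assume "bounded (iter \<eta> k ` {0..})"
  then obtain B where B: "\<And>x. 0 \<le> x \<Longrightarrow> \<bar>iter \<eta> k x\<bar> \<le> B"
    by (auto simp: bounded_iff)
  obtain d where d: "0 < d" "eventually (\<lambda>u. u * exp (- d * ln u powr (real k * \<beta>)) \<le> iter \<eta> k u) at_top"
    using iter_lower_bound[OF \<eta> k] by blast
  have "filterlim (\<lambda>u. u * exp (- d * ln u powr (real k * \<beta>))) at_top at_top"
    by (rule filterlim_x_exp_neg_ln_powr) (use k d \<beta> in auto)
  then have "eventually (\<lambda>u. B < u * exp (- d * ln u powr (real k * \<beta>))) at_top"
    by (simp add: filterlim_at_top_dense)
  with d(2) eventually_ge_at_top[of 0] have "eventually (\<lambda>u::real. False) at_top"
  proof eventually_elim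
    case (elim u)
    then show ?case using B[of u] by linarith
  qed
  then show False by simp
qed

lemma exists_last_subcritical: "\<exists>k. real k * \<beta> \<le> 1 \<and> 1 < real (Suc k) * \<beta>"
proof -
  have ex: "\<exists>m. 1 < real m * \<beta>" using \<beta> reals_Archimedean3 by blast
  define m where "m = (LEAST m. 1 < real m * \<beta>)"
  have m: "1 < real m * \<beta>" unfolding m_def by (rule LeastI_ex[OF ex])
  then obtain k where k: "m = Suc k" by (cases m) auto
  then have "\<not> 1 < real k * \<beta>" using not_less_Least[of k "\<lambda>m. 1 < real m * \<beta>"] m_def by simp
  then have "real k * \<beta> \<le> 1 \<and> 1 < real (Suc k) * \<beta>" using m unfolding k by linarith
  then show ?thesis ..
qed
end

section \<open>The threshold and its one-sided limits\<close>

context log_power_rate begin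

text \<open>This is the quantity \<open>i_eta\<close> for a weight whose rate is \<open>H\<close>.\<close>

definition threshold :: "real \<Rightarrow> enat" where
  "threshold \<eta> = (INF n \<in> {n. n \<ge> 2 \<and> bounded (iter \<eta> (n - 1) ` {0..})}. enat n)"

lemma threshold_mono:
  assumes "0 < \<eta>" "\<eta> \<le> \<eta>'"
  shows "threshold \<eta> \<le> threshold \<eta>'"
  unfolding threshold_def
  by (rule INF_superset_mono) (use bounded_iter_mono[of \<eta> \<eta>'] assms in auto)

lemma threshold_le:
  assumes "0 < \<eta>" "\<eta> < 1" "real k * \<beta> \<le> 1" "1 < real (Suc k) * \<beta>"
  shows "threshold \<eta> \<le> enat (k + 2)"
  unfolding threshold_def using bounded_iter[OF assms] by (intro INF_lower) simp

lemma threshold_ge: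
  assumes "0 < \<eta>" "\<eta> < 1" "real k * \<beta> < 1"
  shows "enat (k + 2) \<le> threshold \<eta>"
  unfolding threshold_def
proof (rule INF_greatest)
  fix n assume n: "n \<in> {n. n \<ge> 2 \<and> bounded (iter \<eta> (n - 1) ` {0..})}"
  have "\<not> n - 1 \<le> k"
  proof
    assume "n - 1 \<le> k"
    then have "real (n - 1) * \<beta> \<le> real k * \<beta>" using \<beta> by (intro mult_right_mono) auto
    then have "real (n - 1) * \<beta> < 1" using assms(3) by linarith
    from unbounded_iter[OF assms(1,2) this] n show False by simp
  qed
  then show "enat (k + 2) \<le> enat n" by simp
qed

lemma threshold_finite:
  assumes "0 < \<eta>" "\<eta> < 1"
  shows "threshold \<eta> \<noteq> \<infinity>"
proof -
  obtain k where "real k * \<beta> \<le> 1" "1 < real (Suc k) * \<beta>" using exists_last_subcritical by blast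
  from threshold_le[OF assms this] show ?thesis by (cases "threshold \<eta>") auto
qed

lemma threshold_eq:
  assumes "0 < \<eta>" "\<eta> < 1" "real k * \<beta> < 1" "1 < real (Suc k) * \<beta>"
  shows "threshold \<eta> = enat (k + 2)"
  using threshold_le[of \<eta> k] threshold_ge[of \<eta> k] assms by (intro antisym) auto

end

text \<open>On the left of \<open>z\<close> the values are natural numbers bounded by \<open>f z\<close>, so their supremum is
  attained; on the right their infimum is attained by well-ordering. By monotonicity \<open>f\<close>
  is constant between a point where this happens and \<open>z\<close>.\<close>

lemma Lim_one_sided_finite:
  fixes f :: "real \<Rightarrow> enat"
  assumes mono: "\<And>x y. 0 < x \<Longrightarrow> x \<le> y \<Longrightarrow> y < 1 \<Longrightarrow> f x \<le> f y"
    and fin: "\<And>x. 0 < x \<Longrightarrow> x < 1 \<Longrightarrow> f x \<noteq> \<infinity>"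
    and z: "0 < z" "z < 1"
  shows "Lim (at_left z) f \<noteq> \<infinity>" "Lim (at_right z) f \<noteq> \<infinity>"
proof -
  obtain m where m: "f z = enat m" using fin[OF z] by auto
  have finS: "finite (f ` {0<..<z})"
    by (rule finite_enat_bounded[of _ m]) (use mono z in \<open>auto simp flip: m\<close>)
  have ne: "f ` {0<..<z} \<noteq> {}" using z by simp
  obtain x where x: "0 < x" "x < z" "Max (f ` {0<..<z}) = f x" using Max_in[OF finS ne] by auto
  have "f y = f x" if "x < y" "y < z" for y
    using Max_ge[OF finS, of "f y"] mono[of x y] that x z by force
  then have "eventually (\<lambda>y. f y = f x) (at_left z)"
    unfolding eventually_at_left[OF x(2)] using x by blast
  then have "Lim (at_left z) f = f x"
    by (intro tendsto_Lim tendsto_eventually) auto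
  then show "Lim (at_left z) f \<noteq> \<infinity>" using fin[of x] x z by simp
  define L where "L = (LEAST l. l \<in> f ` {z<..<1})"
  have "\<exists>l. l \<in> f ` {z<..<1}" using z dense by force
  then have "L \<in> f ` {z<..<1}" unfolding L_def by (rule LeastI_ex)
  then obtain x' where x': "z < x'" "x' < 1" "L = f x'" by auto
  have "f y = f x'" if "z < y" "y < x'" for y
    using Least_le[of "\<lambda>l. l \<in> f ` {z<..<1}" "f y"] mono[of y x'] that x' z
    unfolding L_def[symmetric] by force
  then have "eventually (\<lambda>y. f y = f x') (at_right z)"
    unfolding eventually_at_right[OF x'(1)] using x' by blast
  then have "Lim (at_right z) f = f x'"
    by (intro tendsto_Lim tendsto_eventually) auto
  then show "Lim (at_right z) f \<noteq> \<infinity>" using fin[of x'] x' z by simp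
qed

lemma Lim_one_sided_const:
  fixes f :: "real \<Rightarrow> enat"
  assumes "\<And>x. 0 < x \<Longrightarrow> x < 1 \<Longrightarrow> f x = L" and z: "0 < z" "z < 1"
  shows "Lim (at_left z) f = L" "Lim (at_right z) f = L"
proof -
  have "eventually (\<lambda>y. f y = L) (at_left z)"
    unfolding eventually_at_left[OF z(1)] using assms by (intro exI[of _ 0]) auto
  then show "Lim (at_left z) f = L" by (intro tendsto_Lim tendsto_eventually) auto
  have "eventually (\<lambda>y. f y = L) (at_right z)"
    unfolding eventually_at_right[OF z(2)] using assms by (intro exI[of _ 1]) auto
  then show "Lim (at_right z) f = L" by (intro tendsto_Lim tendsto_eventually) auto
qed

theorem proposition1p5:
  fixes w :: "nat \<Rightarrow> real" and \<alpha> :: real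
  assumes "\<And>k. w k > 0"
    and "mono w"
    and "0 < \<alpha>" and "\<alpha> < 1"
    and "w \<sim>[at_top] (\<lambda>k. real k / exp (ln (real k) powr \<alpha>))"
  shows "i_minus w \<noteq> \<infinity> \<and> i_plus w \<noteq> \<infinity> \<and>
    (\<forall>n::nat. n \<ge> 1 \<longrightarrow> \<alpha> \<in> {(real n - 1) / real n <..< real n / (real n + 1)} \<longrightarrow>
       i_minus w = enat (n + 1) \<and> i_plus w = enat (n + 1))"
proof -
  note W_unb = W_unbounded[OF assms]
  define H where "H y = interp w (W_inv w y)" for y
  obtain u0 c C K where cs: "1 < u0" "0 < c" "0 < C" and
    b: "\<And>v u. u0 \<le> v \<Longrightarrow> v \<le> u \<Longrightarrow> c * ln u powr (1/\<alpha> - 1) * (ln u - ln v) - K \<le> ln (H u) - ln (H v)"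
       "\<And>v u. u0 \<le> v \<Longrightarrow> v \<le> u \<Longrightarrow> ln (H u) - ln (H v) \<le> C * ln u powr (1/\<alpha> - 1) * (ln u - ln v) + K"
    using ln_interp_W_inv_increments[OF assms] unfolding H_def by blast
  note W_inv_nn = W_inv_nonneg[OF assms(1,2) W_unb]
  interpret log_power_rate H "1/\<alpha> - 1" u0 c C K
  proof
    have "W_inv w ` {0..} \<subseteq> {0..}" using W_inv_nn by auto
    then show "continuous_on {0..} H"
      unfolding H_def[abs_def]
      by (rule continuous_on_compose2[OF continuous_on_interp continuous_on_W_inv[OF assms(1,2) W_unb]])
    show "H x \<le> H y" if "0 \<le> x" "x \<le> y" for x y
      unfolding H_def using that W_inv_nn[of x]
      by (intro interp_mono[OF assms(2)] W_inv_mono[OF assms(1,2) W_unb]) auto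
    show "0 < H x" if "0 \<le> x" for x
      unfolding H_def by (rule interp_pos[OF assms(1,2) W_inv_nn[OF that]])
    show "0 < 1/\<alpha> - 1" using assms(3,4) by (simp add: field_simps)
  qed (use cs b in auto)
  have "G w = ratio_primitive H"
    by (intro ext) (simp add: G_def ratio_primitive_def H_def)
  then have i_eta: "i_eta w = threshold"
    by (intro ext) (simp add: i_eta_def threshold_def)
  have "i_minus w \<noteq> \<infinity> \<and> i_plus w \<noteq> \<infinity>"
    unfolding i_minus_def i_plus_def i_eta
    using Lim_one_sided_finite[of threshold "1/2"] threshold_mono threshold_finite by auto
  moreover have "i_minus w = enat (n + 1) \<and> i_plus w = enat (n + 1)"
    if n: "n \<ge> 1" "\<alpha> \<in> {(real n - 1) / real n <..< real n / (real n + 1)}" for n :: nat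
  proof -
    obtain k where k: "n = Suc k" using n(1) by (cases n) auto
    have a: "real k < \<alpha> * (real k + 1)" "\<alpha> * (real k + 2) < real k + 1"
      using n(2) unfolding k by (simp_all add: field_simps)
    have "real k * (1/\<alpha> - 1) < 1" "1 < real (Suc k) * (1/\<alpha> - 1)"
      using a assms(3) by (simp_all add: field_simps)
    then have "threshold \<eta> = enat (n + 1)" if "0 < \<eta>" "\<eta> < 1" for \<eta>
      using threshold_eq[OF that, of k] k by simp
    then show ?thesis
      unfolding i_minus_def i_plus_def i_eta
      using Lim_one_sided_const[of threshold "enat (n + 1)" "1/2"] by auto
  qed
  ultimately show ?thesis by blast
qed

end
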